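(* Let $A:\mathcal F_\lambda\otimes\mathcal F_\gamma\otimes\mathcal F_\tau\to\mathcal F_{\lambda+\gamma+\tau+5}$ be a $\mathfrak{vect}(1)$-invariant ternary differential operator of order $5$. Then, up to permutations and dualizations, $A$ is a multiple of one of the following operators, evaluated on $\varphi(dx)^\lambda\otimes\psi(dx)^\gamma\otimes\chi(dx)^\tau$, where the $\epsilon_i$ are constants: (1) for $(\lambda,\gamma,\tau)=(0,0,0)$: $\ \epsilon_1\{\{d\varphi,d\psi\},d\chi\}+\epsilon_2\{\{d\chi,d\varphi\},d\psi\}$; (2) for $(\lambda,\gamma,\tau)=(0,0,-2)$: $\ \epsilon_1\{d\{d\varphi,\chi(dx)^{-2}\},d\psi\}+\epsilon_2\{d\{d\psi,\chi(dx)^{-2}\},d\varphi\}$; (3) for $(\lambda,\gamma)=(0,0)$ and $\tau\neq-4,-2,0$: $\ \Delta_{1,1,\tau;3}(d\varphi,d\psi,\chi(dx)^\tau)$; (4) for $(\lambda,\gamma,\tau)=(-\frac23,-\frac23,0)$: $\ \{\mathrm{Gz}(\varphi(dx)^{-2/3},\psi(dx)^{-2/3}),d\chi\}$; (5) for $(\lambda,\gamma,\tau)=(-\frac52,0,1)$: $\ \Xi(\varphi(dx)^{-5/2},d\psi,\chi\,dx)$; (6) for $(\lambda,\gamma,\tau)=(-\frac23,-\frac23,-\frac43)$: $\ \Gamma(\varphi(dx)^\lambda,\psi(dx)^\gamma,\chi(dx)^\tau)$; (7) for $\lambda=\gamma=\tau=-\frac1{12}(9\pm\sqrt{21})$: $\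 \Theta_\pm(\varphi(dx)^\lambda,\psi(dx)^\gamma,\chi(dx)^\tau)$.
   Context: For $\lambda\in\mathbb R$, $\mathcal F_\lambda=\{f(dx)^\lambda : f\in\mathbb R[x]\}$ is the space of weighted densities of weight $\lambda$ on $\mathbb R$. The Lie algebra $\mathfrak{vect}(1)$ of polynomial vector fields $X=h\frac{d}{dx}$, $h\in\mathbb R[x]$, acts on $\mathcal F_\lambda$ by $L_X(f(dx)^\lambda)=(hf'+\lambda h'f)(dx)^\lambda$. Densities are multiplied by $f(dx)^\lambda\cdot g(dx)^\mu=fg(dx)^{\lambda+\mu}$, and $\mathcal F_0$ is the space of functions. A ternary differential operator $A:\mathcal F_\lambda\otimes\mathcal F_\gamma\otimes\mathcal F_\tau\to\mathcal F_\mu$ is $\mathfrak{vect}(1)$-invariant if $L_X A(a,b,c)=A(L_Xa,b,c)+A(a,L_Xb,c)+A(a,b,L_Xc)$ for all $X\in\mathfrak{vect}(1)$. An invariant operator of order $k$ has the form $\varphi(dx)^\lambda\otimes\psi(dx)^\gamma\otimes\chi(dx)^\tau\mapsto\sum_{i+j+l=k}\alpha_{i,j,l}\varphi^{(i)}\psi^{(j)}\chi^{(l)}(dx)^\mu$ with constants $\alpha_{i,j,l}\in\mathbb R$ and $\mu=\lambda+\gamma+\tau+k$. De Rham differential: $d:\mathcal F_0\to\mathcal F_1$, $d\varphi=\varphi'dx$. Poisson bracket: $\{\varphi(dx)^\lambda,\psi(dx)^\mu\}=(-\lambda\varphi\psi'+\mu\varphi'\psi)(dx)^{\lambda+\mu+1}$.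 Grozman operator: $\mathrm{Gz}:\mathcal F_{-2/3}\otimes\mathcal F_{-2/3}\to\mathcal F_{5/3}$, $\mathrm{Gz}(\varphi(dx)^{-2/3},\psi(dx)^{-2/3})=(2\varphi'''\psi+3\varphi''\psi'-3\varphi'\psi''-2\varphi\psi''')(dx)^{5/3}$. Dualizations: for $A=\sum\alpha_{i,j,l}\varphi^{(i)}\psi^{(j)}\chi^{(l)}$ from $\mathcal F_\lambda\otimes\mathcal F_\gamma\otimes\mathcal F_\tau$ to $\mathcal F_\mu$, the three dualizations are the formal adjoints (via integration by parts, $(\mathcal F_\alpha)^*:=\mathcal F_{1-\alpha}$) in each argument. $A^{*1}:\mathcal F_{1-\mu}\otimes\mathcal F_\gamma\otimes\mathcal F_\tau\to\mathcal F_{1-\lambda}$ is $(\omega,\psi,\chi)\mapsto\sum\alpha_{i,j,l}(-1)^i(\omega\psi^{(j)}\chi^{(l)})^{(i)}$; $A^{*2}:\mathcal F_\lambda\otimes\mathcal F_{1-\mu}\otimes\mathcal F_\tau\to\mathcal F_{1-\gamma}$ and $A^{*3}:\mathcal F_\lambda\otimes\mathcal F_\gamma\otimes\mathcal F_{1-\mu}\to\mathcal F_{1-\tau}$ are defined analogously. Permutations: for $\sigma\in S_3$, $A^\sigma(a,b,c)=A(\sigma^{-1}(a,b,c))$, with the weights permuted accordingly. "Up to permutations and dualizations" means after applying finitely many of these operations. The operator $\Delta_{\lambda,\gamma,\tau;3}:\mathcal F_\lambda\otimes\mathcal F_\gamma\otimes\mathcal F_\tau\to\mathcal F_{\lambda+\gamma+\tau+3}$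 is $\sum_{i+j+l=3}\alpha_{i,j,l}\varphi^{(i)}\psi^{(j)}\chi^{(l)}(dx)^{\lambda+\gamma+\tau+3}$ with $\alpha_{3,0,0}=\gamma\tau(\tau-\gamma)(1+\gamma+\tau)$, $\alpha_{0,3,0}=\lambda\tau(\lambda-\tau)(1+\lambda+\tau)$, $\alpha_{0,0,3}=\gamma\lambda(\gamma-\lambda)(1+\gamma+\lambda)$, $\alpha_{1,1,1}=(\lambda-\gamma)(\gamma-\tau)(\lambda-\tau)$, $\alpha_{2,1,0}=\tau(1+\gamma+\tau)(2\lambda+\tau+\gamma(3\lambda+3\tau+4)+2)$, $\alpha_{1,2,0}=-\tau(1+\lambda+\tau)(2\gamma+\tau+\lambda(3\gamma+3\tau+4)+2)$, $\alpha_{2,0,1}=-\gamma(1+\gamma+\tau)(\gamma+2\lambda+(3\gamma+3\lambda+4)\tau+2)$, $\alpha_{1,0,2}=\gamma(1+\gamma+\lambda)(\gamma+2\tau+\lambda(3\gamma+3\tau+4)+2)$, $\alpha_{0,2,1}=\lambda(1+\lambda+\tau)(2\gamma+\lambda+(3\gamma+3\lambda+4)\tau+2)$, $\alpha_{0,1,2}=-\lambda(1+\gamma+\lambda)(\lambda+2\tau+\gamma(3\lambda+3\tau+4)+2)$. In case (3) it is taken with weights $(1,1,\tau)$. For $\tau\neq-\frac34$, $\Xi:\mathcal F_{-\tau-3/2}\otimes\mathcal F_\tau\otimes\mathcal F_\tau\to\mathcal F_{\tau+5/2}$ is $\sum_{i+j+l=4}\alpha_{i,j,l}\varphi^{(i)}\psi^{(j)}\chi^{(l)}(dx)^{\tau+5/2}$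 with $\alpha_{4,0,0}=\alpha_{0,2,2}=\alpha_{2,1,1}=0$, $\alpha_{0,4,0}=-\tau(3+2\tau)$, $\alpha_{0,0,4}=\tau(3+2\tau)$, $\alpha_{3,1,0}=-\frac83\tau(2+3\tau)$, $\alpha_{3,0,1}=\frac83\tau(2+3\tau)$, $\alpha_{1,3,0}=-\frac23\tau(13+12\tau)$, $\alpha_{1,0,3}=\frac23\tau(13+12\tau)$, $\alpha_{0,3,1}=\frac53(3+2\tau)$, $\alpha_{0,1,3}=-\frac53(3+2\tau)$, $\alpha_{2,2,0}=-4\tau(2+3\tau)$, $\alpha_{2,0,2}=4\tau(2+3\tau)$, $\alpha_{1,2,1}=10(1+\tau)$, $\alpha_{1,1,2}=-10(1+\tau)$. In case (5), $\Xi$ is taken with $\tau=1$. $\Gamma:\mathcal F_{-2/3}\otimes\mathcal F_{-2/3}\otimes\mathcal F_{-4/3}\to\mathcal F_{7/3}$ is $\sum_{i+j+l=5}\alpha_{i,j,l}\varphi^{(i)}\psi^{(j)}\chi^{(l)}(dx)^{7/3}$ with $\alpha_{0,0,5}=\frac25$, $\alpha_{0,1,4}=\alpha_{1,0,4}=1$, $\alpha_{0,2,3}=\alpha_{2,0,3}=-1$, $\alpha_{0,3,2}=\alpha_{3,0,2}=-\frac52$, $\alpha_{0,4,1}=\alpha_{4,0,1}=-\frac{17}{10}$, $\alpha_{0,5,0}=\alpha_{5,0,0}=-\frac25$, $\alpha_{1,1,3}=\frac32$, $\alpha_{1,2,2}=\alpha_{2,1,2}=-\frac94$, $\alpha_{1,3,1}=\alpha_{3,1,1}=-\frac94$,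 $\alpha_{1,4,0}=\alpha_{4,1,0}=-\frac35$, $\alpha_{2,2,1}=\frac92$, $\alpha_{2,3,0}=\alpha_{3,2,0}=3$. With $\kappa=-\frac1{12}(9\pm\sqrt{21})$, $\Theta_\pm:\wedge^3\mathcal F_\kappa\to\mathcal F_{3\kappa+5}$ is $$\left(\begin{vmatrix}\varphi&\psi&\chi\\ \varphi'&\psi'&\chi'\\ \varphi^{(4)}&\psi^{(4)}&\chi^{(4)}\end{vmatrix}+2(\pm\sqrt{21}-4)\begin{vmatrix}\varphi&\psi&\chi\\ \varphi''&\psi''&\chi''\\ \varphi^{(3)}&\psi^{(3)}&\chi^{(3)}\end{vmatrix}\right)(dx)^{3\kappa+5},$$ the signs in $\kappa$ and in the coefficient being the same. *)

theory Defs
  imports "HOL-Analysis.Analysis" "HOL-Computational_Algebra.Polynomial"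
begin

text \<open>
  A density \<open>f (dx)^w\<close> with polynomial coefficient is represented by its coefficient \<open>f\<close>; the
  weight \<open>w\<close> is passed explicitly to every operation that depends on it. A polynomial vector field
  \<open>h d/dx\<close> is likewise represented by \<open>h\<close>.
\<close>

type_synonym density = "real poly"

abbreviation D :: "nat \<Rightarrow> density \<Rightarrow> density" where
  "D k \<equiv> pderiv ^^ k"

definition Lie :: "real \<Rightarrow> real poly \<Rightarrow> density \<Rightarrow> density" where
  "Lie w h f = h * pderiv f + smult w (pderiv h * f)"

definition vect_invariant ::
  "real \<Rightarrow> real \<Rightarrow> real \<Rightarrow> real \<Rightarrow> (density \<Rightarrow> density \<Rightarrow> density \<Rightarrow> density) \<Rightarrow> bool" where
  "vect_invariant lam \<gamma> \<tau> \<mu> A \<longleftrightarrow>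
     (\<forall>h a b c. Lie \<mu> h (A a b c) =
        A (Lie lam h a) b c + A a (Lie \<gamma> h b) c + A a b (Lie \<tau> h c))"

text \<open>
  Ternary differential operators with polynomial coefficients. The coefficients of an operator of
  order at most \<open>k\<close> are determined by the operator for indices with \<open>i + j + l \<le> k\<close>. That invariant
  operators are homogeneous with constant coefficients is not built in.
\<close>

definition diffop ::
  "nat \<Rightarrow> (nat \<Rightarrow> nat \<Rightarrow> nat \<Rightarrow> real poly) \<Rightarrow> density \<Rightarrow> density \<Rightarrow> density \<Rightarrow> density" where
  "diffop k \<alpha> \<phi> \<psi> chi =
     (\<Sum>(i, j, l) \<in> {(i, j, l). i + j + l \<le> k}. \<alpha> i j l * D i \<phi> * D j \<psi> * D l chi)"

definition diffop_of_order :: "nat \<Rightarrow> (density \<Rightarrow> density \<Rightarrow> density \<Rightarrow> density) \<Rightarrow> bool" where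
  "diffop_of_order k A \<longleftrightarrow>
     (\<exists>\<alpha>. A = diffop k \<alpha> \<and> (\<exists>i j l. i + j + l = k \<and> \<alpha> i j l \<noteq> 0))"

text \<open>Formal adjoints with respect to each argument; the argument replaced is named \<open>\<omega>\<close>.\<close>

definition adjoint1 ::
  "nat \<Rightarrow> (nat \<Rightarrow> nat \<Rightarrow> nat \<Rightarrow> real poly) \<Rightarrow> density \<Rightarrow> density \<Rightarrow> density \<Rightarrow> density" where
  "adjoint1 k \<alpha> \<omega> \<psi> chi =
     (\<Sum>(i, j, l) \<in> {(i, j, l). i + j + l \<le> k}.
        smult ((-1) ^ i) (D i (\<alpha> i j l * \<omega> * D j \<psi> * D l chi)))"

definition adjoint2 ::
  "nat \<Rightarrow> (nat \<Rightarrow> nat \<Rightarrow> nat \<Rightarrow> real poly) \<Rightarrow> density \<Rightarrow> density \<Rightarrow> density \<Rightarrow> density" where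
  "adjoint2 k \<alpha> \<phi> \<omega> chi =
     (\<Sum>(i, j, l) \<in> {(i, j, l). i + j + l \<le> k}.
        smult ((-1) ^ j) (D j (\<alpha> i j l * D i \<phi> * \<omega> * D l chi)))"

definition adjoint3 ::
  "nat \<Rightarrow> (nat \<Rightarrow> nat \<Rightarrow> nat \<Rightarrow> real poly) \<Rightarrow> density \<Rightarrow> density \<Rightarrow> density \<Rightarrow> density" where
  "adjoint3 k \<alpha> \<phi> \<psi> \<omega> =
     (\<Sum>(i, j, l) \<in> {(i, j, l). i + j + l \<le> k}.
        smult ((-1) ^ l) (D l (\<alpha> i j l * D i \<phi> * D j \<psi> * \<omega>)))"

text \<open>
  \<open>TernOp lam \<gamma> \<tau> \<mu> A\<close> is the operator \<open>A\<close> regarded as a map from densities of weights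
  \<open>lam\<close>, \<open>\<gamma>\<close>, \<open>\<tau>\<close> to densities of weight \<open>\<mu>\<close>.
\<close>

datatype tern_op = TernOp real real real real "density \<Rightarrow> density \<Rightarrow> density \<Rightarrow> density"

text \<open>
  One permutation or dualization. Argument slots are numbered 0, 1, 2, and
  \<open>\<sigma>\<^sup>-\<^sup>1 (x\<^sub>0, x\<^sub>1, x\<^sub>2) = (x (\<sigma> 0), x (\<sigma> 1), x (\<sigma> 2))\<close>; thus argument \<open>n\<close> of the permuted operator is
  fed into slot \<open>inv \<sigma> n\<close> of \<open>A\<close> and has the weight of that slot.
\<close>

inductive perm_dual_step :: "tern_op \<Rightarrow> tern_op \<Rightarrow> bool" where
  perm: "\<sigma> permutes {..<3} \<Longrightarrow>
     perm_dual_step (TernOp (w 0) (w 1) (w 2) \<mu> A)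
       (TernOp (w (inv \<sigma> 0)) (w (inv \<sigma> 1)) (w (inv \<sigma> 2)) \<mu>
         (\<lambda>a b c. let x = (\<lambda>n. [a, b, c] ! n) in A (x (\<sigma> 0)) (x (\<sigma> 1)) (x (\<sigma> 2))))"
    for w :: "nat \<Rightarrow> real"
| dual1: "A = diffop k \<alpha> \<Longrightarrow>
     perm_dual_step (TernOp lam \<gamma> \<tau> \<mu> A) (TernOp (1 - \<mu>) \<gamma> \<tau> (1 - lam) (adjoint1 k \<alpha>))"
| dual2: "A = diffop k \<alpha> \<Longrightarrow>
     perm_dual_step (TernOp lam \<gamma> \<tau> \<mu> A) (TernOp lam (1 - \<mu>) \<tau> (1 - \<gamma>) (adjoint2 k \<alpha>))"
| dual3: "A = diffop k \<alpha> \<Longrightarrow>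
     perm_dual_step (TernOp lam \<gamma> \<tau> \<mu> A) (TernOp lam \<gamma> (1 - \<mu>) (1 - \<tau>) (adjoint3 k \<alpha>))"

abbreviation perm_dual :: "tern_op \<Rightarrow> tern_op \<Rightarrow> bool" where
  "perm_dual \<equiv> perm_dual_step\<^sup>*\<^sup>*"

text \<open>De Rham differential from weight 0 to weight 1.\<close>

definition dR :: "density \<Rightarrow> density" where
  "dR \<phi> = pderiv \<phi>"

text \<open>\<open>poisson u v\<close> takes densities of weights \<open>u\<close> and \<open>v\<close> to a density of weight \<open>u + v + 1\<close>.\<close>

definition poisson :: "real \<Rightarrow> real \<Rightarrow> density \<Rightarrow> density \<Rightarrow> density" where
  "poisson u v \<phi> \<psi> = smult (- u) (\<phi> * pderiv \<psi>) + smult v (pderiv \<phi> * \<psi>)"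

text \<open>Grozman operator, with arguments of weight \<open>-2/3\<close> and values of weight \<open>5/3\<close>.\<close>

definition Gz :: "density \<Rightarrow> density \<Rightarrow> density" where
  "Gz \<phi> \<psi> = smult 2 (D 3 \<phi> * \<psi>) + smult 3 (D 2 \<phi> * D 1 \<psi>)
            - smult 3 (D 1 \<phi> * D 2 \<psi>) - smult 2 (\<phi> * D 3 \<psi>)"

text \<open>The constant-coefficient operator with the given list of coefficients.\<close>

definition op_of_coeffs ::
  "((nat \<times> nat \<times> nat) \<times> real) list \<Rightarrow> density \<Rightarrow> density \<Rightarrow> density \<Rightarrow> density" where
  "op_of_coeffs cs \<phi> \<psi> chi = (\<Sum>((i, j, l), a) \<leftarrow> cs. smult a (D i \<phi> * D j \<psi> * D l chi))"

definition Delta3 :: "real \<Rightarrow> real \<Rightarrow> real \<Rightarrow> density \<Rightarrow> density \<Rightarrow> density \<Rightarrow> density" where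
  "Delta3 lam \<gamma> \<tau> = op_of_coeffs
    [((3,0,0), \<gamma> * \<tau> * (\<tau> - \<gamma>) * (1 + \<gamma> + \<tau>)),
     ((0,3,0), lam * \<tau> * (lam - \<tau>) * (1 + lam + \<tau>)),
     ((0,0,3), \<gamma> * lam * (\<gamma> - lam) * (1 + \<gamma> + lam)),
     ((1,1,1), (lam - \<gamma>) * (\<gamma> - \<tau>) * (lam - \<tau>)),
     ((2,1,0), \<tau> * (1 + \<gamma> + \<tau>) * (2 * lam + \<tau> + \<gamma> * (3 * lam + 3 * \<tau> + 4) + 2)),
     ((1,2,0), - \<tau> * (1 + lam + \<tau>) * (2 * \<gamma> + \<tau> + lam * (3 * \<gamma> + 3 * \<tau> + 4) + 2)),
     ((2,0,1), - \<gamma> * (1 + \<gamma> + \<tau>) * (\<gamma> + 2 * lam + (3 * \<gamma> + 3 * lam + 4) * \<tau> + 2)),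
     ((1,0,2), \<gamma> * (1 + \<gamma> + lam) * (\<gamma> + 2 * \<tau> + lam * (3 * \<gamma> + 3 * \<tau> + 4) + 2)),
     ((0,2,1), lam * (1 + lam + \<tau>) * (2 * \<gamma> + lam + (3 * \<gamma> + 3 * lam + 4) * \<tau> + 2)),
     ((0,1,2), - lam * (1 + \<gamma> + lam) * (lam + 2 * \<tau> + \<gamma> * (3 * lam + 3 * \<tau> + 4) + 2))]"

text \<open>\<open>Xi \<tau>\<close> takes weights \<open>-\<tau> - 3/2\<close>, \<open>\<tau>\<close>, \<open>\<tau>\<close> to weight \<open>\<tau> + 5/2\<close>.\<close>

definition Xi :: "real \<Rightarrow> density \<Rightarrow> density \<Rightarrow> density \<Rightarrow> density" where
  "Xi \<tau> = op_of_coeffs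
    [((4,0,0), 0), ((0,2,2), 0), ((2,1,1), 0),
     ((0,4,0), - \<tau> * (3 + 2 * \<tau>)),
     ((0,0,4), \<tau> * (3 + 2 * \<tau>)),
     ((3,1,0), - (8/3) * \<tau> * (2 + 3 * \<tau>)),
     ((3,0,1), (8/3) * \<tau> * (2 + 3 * \<tau>)),
     ((1,3,0), - (2/3) * \<tau> * (13 + 12 * \<tau>)),
     ((1,0,3), (2/3) * \<tau> * (13 + 12 * \<tau>)),
     ((0,3,1), (5/3) * (3 + 2 * \<tau>)),
     ((0,1,3), - (5/3) * (3 + 2 * \<tau>)),
     ((2,2,0), - 4 * \<tau> * (2 + 3 * \<tau>)),
     ((2,0,2), 4 * \<tau> * (2 + 3 * \<tau>)),
     ((1,2,1), 10 * (1 + \<tau>)),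
     ((1,1,2), - 10 * (1 + \<tau>))]"

text \<open>Weights \<open>-2/3\<close>, \<open>-2/3\<close>, \<open>-4/3\<close> to weight \<open>7/3\<close>.\<close>

definition Gamma_op :: "density \<Rightarrow> density \<Rightarrow> density \<Rightarrow> density" where
  "Gamma_op = op_of_coeffs
    [((0,0,5), 2/5),
     ((0,1,4), 1), ((1,0,4), 1),
     ((0,2,3), -1), ((2,0,3), -1),
     ((0,3,2), -5/2), ((3,0,2), -5/2),
     ((0,4,1), -17/10), ((4,0,1), -17/10),
     ((0,5,0), -2/5), ((5,0,0), -2/5),
     ((1,1,3), 3/2),
     ((1,2,2), -9/4), ((2,1,2), -9/4),
     ((1,3,1), -9/4), ((3,1,1), -9/4),
     ((1,4,0), -3/5), ((4,1,0), -3/5),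
     ((2,2,1), 9/2),
     ((2,3,0), 3), ((3,2,0), 3)]"

text \<open>\<open>s\<close> is the sign, \<open>1\<close> or \<open>-1\<close>; all three arguments have weight \<open>Theta_weight s\<close>.\<close>

definition Theta_weight :: "real \<Rightarrow> real" where
  "Theta_weight s = - (1/12) * (9 + s * sqrt 21)"

definition Theta :: "real \<Rightarrow> density \<Rightarrow> density \<Rightarrow> density \<Rightarrow> density" where
  "Theta s \<phi> \<psi> chi =
     det (vector [vector [\<phi>, \<psi>, chi],
                  vector [D 1 \<phi>, D 1 \<psi>, D 1 chi],
                  vector [D 4 \<phi>, D 4 \<psi>, D 4 chi]] :: real poly ^ 3 ^ 3)
     + smult (2 * (s * sqrt 21 - 4))
     (det (vector [vector [\<phi>, \<psi>, chi],
                   vector [D 2 \<phi>, D 2 \<psi>, D 2 chi],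
                   vector [D 3 \<phi>, D 3 \<psi>, D 3 chi]] :: real poly ^ 3 ^ 3))"

end

theory Submission
  imports Defs
begin

text \<open>
  Invariance under \<open>d/dx\<close> and \<open>x d/dx\<close> forces an invariant operator to have constant coefficients
  and to be homogeneous, so it is a ternary quintic form \<open>P(x, y, z)\<close> with coefficients \<open>c i j l\<close>,
  the variables standing for differentiation of the three arguments. The fields \<open>x^(s+1) d/dx\<close>,
  \<open>1 \<le> s \<le> 5\<close>, impose linear equations on \<open>c\<close> whose coefficients are affine in the weights.

  Put \<open>w = - x - y - z\<close> and let \<open>\<rho> = - 4 - lam - \<gamma> - \<tau>\<close> be the weight dual to that of the values.
  Integration by parts exchanges \<open>x\<close> and \<open>w\<close>, and with them \<open>lam\<close> and \<open>\<rho>\<close>. Permutations and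
  dualizations therefore act as the symmetric group on the four variables and on the four weights,
  whose sum is \<open>- 4\<close>. It remains to decide for which weights there is a nonzero solution, and to
  match the solutions with the listed operators at one representative of each orbit.

  \<^bold>\<open>No weight is zero.\<close> Regard \<open>P\<close> as a plane quintic. The coordinate lines \<open>x\<close>, \<open>y\<close>, \<open>z\<close>, \<open>w\<close> meet
  in six points \<open>e_i - e_j\<close>. The field \<open>x^6 d/dx\<close> says that the values of \<open>P\<close> there, multiplied by
  the two weights, form an antisymmetric matrix with zero row sums, hence three parameters
  \<open>X\<close>, \<open>Y\<close>, \<open>Z\<close>; \<open>x^5 d/dx\<close> then expresses the derivatives at these points (\<open>edge_derivs\<close>), and a binary
  quintic is determined by its values and derivatives at three points, so \<open>P\<close> is known on all four
  lines (\<open>line_coeffs\<close>). Writing the weights as \<open>- 1 \<plusminus> A \<plusminus> B \<plusminus> C\<close>, further equations on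
  the lines give \<open>A X = B Y = C Z\<close> (\<open>vertex_product_eq\<close>) and one relation with its images under the
  symmetries (\<open>edge_relation\<close>). These are simple enough to be solved (\<open>edge_equations_solutions\<close>): since
  \<open>X = Y = Z = 0\<close> forces \<open>P = 0\<close>, only the weights of \<open>\<Gamma>\<close> and of \<open>\<Theta>\<^sub>\<plusminus>\<close> remain.

  \<^bold>\<open>Exactly one weight is zero,\<close> say \<open>lam = 0\<close>. Then \<open>P\<close> vanishes on \<open>x = 0\<close>, because there is no
  invariant binary operator of order 5 for the other weights, and everything is determined by the
  five coefficients \<open>c 1 j l\<close>. They satisfy an overdetermined linear system, and the vanishing of
  its minors leaves the weights of the operators built from \<open>Gz\<close> and \<open>\<Xi>\<close> (\<open>one_zero_weight\<close>).

  \<^bold>\<open>Two weights are zero.\<close> Then one may take \<open>lam = \<gamma> = 0\<close>, where the equations are solved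
  directly: the solutions are the operators in \<open>d\<phi>\<close> and \<open>d\<psi>\<close>.
\<close>

section \<open>Homogeneous operators and their coefficients\<close>

text \<open>
  Only the values \<open>c i j l\<close> with \<open>i + j + l = 5\<close> enter. The operator is given as an instance of \<open>diffop 5\<close>
  because dualization is defined through such a presentation.
\<close>

definition hom_op :: "(nat \<Rightarrow> nat \<Rightarrow> nat \<Rightarrow> real) \<Rightarrow> density \<Rightarrow> density \<Rightarrow> density \<Rightarrow> density" where
  "hom_op c = diffop 5 (\<lambda>i j l. if i + j + l = 5 then [:c i j l:] else 0)"

lemma sum_order_5:
  fixes f :: "nat \<Rightarrow> nat \<Rightarrow> nat \<Rightarrow> 'a :: comm_monoid_add"
  assumes "\<And>i j l. i + j + l \<noteq> 5 \<Longrightarrow> f i j l = 0"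
  shows "(\<Sum>(i, j, l) \<in> {(i, j, l). i + j + l \<le> 5}. f i j l) = (\<Sum>i\<le>5. \<Sum>j\<le>5 - i. f i j (5 - i - j))"
proof -
  have "(\<Sum>(i, j, l) \<in> {(i, j, l). i + j + l \<le> (5::nat)}. f i j l)
      = (\<Sum>(i, j, l) \<in> (\<lambda>(i, j). (i, j, 5 - i - j)) ` (SIGMA i:{..5}. {..5 - i}). f i j l)"
  proof (rule sum.mono_neutral_right)
    have "{(i, j, l). i + j + l \<le> (5::nat)} \<subseteq> {..5} \<times> {..5} \<times> {..5}" by auto
    then show "finite {(i, j, l). i + j + l \<le> (5::nat)}" by (rule finite_subset) auto
    show "(\<lambda>(i, j). (i, j, 5 - i - j)) ` (SIGMA i:{..5}. {..5 - i}) \<subseteq> {(i, j, l). i + j + l \<le> (5::nat)}" by auto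
    show "\<forall>x\<in>{(i, j, l). i + j + l \<le> (5::nat)} - (\<lambda>(i, j). (i, j, 5 - i - j)) ` (SIGMA i:{..5}. {..5 - i}).
      (case x of (i, j, l) \<Rightarrow> f i j l) = 0"
    proof
      fix x
      assume x: "x \<in> {(i, j, l). i + j + l \<le> (5::nat)} - (\<lambda>(i, j). (i, j, 5 - i - j)) ` (SIGMA i:{..5}. {..5 - i})"
      obtain i j l where [simp]: "x = (i, j, l)" by (cases x)
      have "i + j + l \<noteq> 5"
      proof
        assume "i + j + l = 5"
        then have "x = (\<lambda>(i, j). (i, j, 5 - i - j)) (i, j)" "(i, j) \<in> (SIGMA i:{..5}. {..5 - i})"
          by auto
        with x show False by blast
      qed
      then show "(case x of (i, j, l) \<Rightarrow> f i j l) = 0" by (simp add: assms)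
    qed
  qed
  also have "\<dots> = (\<Sum>(i, j) \<in> (SIGMA i:{..5}. {..5 - i}). f i j (5 - i - j))"
    by (subst sum.reindex) (auto simp: inj_on_def case_prod_unfold)
  also have "\<dots> = (\<Sum>i\<le>5. \<Sum>j\<le>5 - i. f i j (5 - i - j))"
    by (rule sum.Sigma[symmetric]) auto
  finally show ?thesis .
qed

lemma sum_atMost_numeral:
  fixes f :: "nat \<Rightarrow> 'a :: comm_monoid_add"
  shows "(\<Sum>i\<le>5. f i) = f 0 + f 1 + f 2 + f 3 + f 4 + f 5"
    and "(\<Sum>i\<le>4. f i) = f 0 + f 1 + f 2 + f 3 + f 4"
    and "(\<Sum>i\<le>3. f i) = f 0 + f 1 + f 2 + f 3"
    and "(\<Sum>i\<le>2. f i) = f 0 + f 1 + f 2"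
    and "(\<Sum>i\<le>1. f i) = f 0 + f 1"
  by (simp_all add: eval_nat_numeral)

lemma hom_op_sum:
  "hom_op c \<phi> \<psi> chi = (\<Sum>i\<le>5. \<Sum>j\<le>5 - i. smult (c i j (5 - i - j)) (D i \<phi> * D j \<psi> * D (5 - i - j) chi))"
  unfolding hom_op_def diffop_def by (subst sum_order_5) (auto intro!: sum.cong)

lemma adj_sum:
  "adjoint1 5 (\<lambda>i j l. if i + j + l = 5 then [:c i j l:] else 0) \<omega> \<psi> chi =
   (\<Sum>i\<le>5. \<Sum>j\<le>5 - i. smult ((-1) ^ i * c i j (5 - i - j)) (D i (\<omega> * D j \<psi> * D (5 - i - j) chi)))"
  unfolding adjoint1_def
  apply (subst sum_order_5)
  subgoal by (simp add: higher_pderiv_0) 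
  apply (auto intro!: sum.cong simp: higher_pderiv_smult)
  done

lemma hom_op_expand:
  "hom_op c \<phi> \<psi> chi =
     smult (c 5 0 0) (D 5 \<phi> * \<psi> * chi) + smult (c 0 5 0) (\<phi> * D 5 \<psi> * chi) + smult (c 0 0 5) (\<phi> * \<psi> * D 5 chi)
   + smult (c 4 1 0) (D 4 \<phi> * D 1 \<psi> * chi) + smult (c 4 0 1) (D 4 \<phi> * \<psi> * D 1 chi)
   + smult (c 1 4 0) (D 1 \<phi> * D 4 \<psi> * chi) + smult (c 0 4 1) (\<phi> * D 4 \<psi> * D 1 chi)
   + smult (c 1 0 4) (D 1 \<phi> * \<psi> * D 4 chi) + smult (c 0 1 4) (\<phi> * D 1 \<psi> * D 4 chi)
   + smult (c 3 2 0) (D 3 \<phi> * D 2 \<psi> * chi) + smult (c 3 0 2) (D 3 \<phi> * \<psi> * D 2 chi)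
   + smult (c 2 3 0) (D 2 \<phi> * D 3 \<psi> * chi) + smult (c 0 3 2) (\<phi> * D 3 \<psi> * D 2 chi)
   + smult (c 2 0 3) (D 2 \<phi> * \<psi> * D 3 chi) + smult (c 0 2 3) (\<phi> * D 2 \<psi> * D 3 chi)
   + smult (c 3 1 1) (D 3 \<phi> * D 1 \<psi> * D 1 chi) + smult (c 1 3 1) (D 1 \<phi> * D 3 \<psi> * D 1 chi)
   + smult (c 1 1 3) (D 1 \<phi> * D 1 \<psi> * D 3 chi) + smult (c 2 2 1) (D 2 \<phi> * D 2 \<psi> * D 1 chi)
   + smult (c 2 1 2) (D 2 \<phi> * D 1 \<psi> * D 2 chi) + smult (c 1 2 2) (D 1 \<phi> * D 2 \<psi> * D 2 chi)"
  unfolding hom_op_sum sum_atMost_numeral by (simp add: sum_atMost_numeral[simplified] add_ac)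

text \<open>
  The divided powers \<open>(x - t)^p / p!\<close> are dual to the functionals \<open>f \<mapsto> f\<^sup>(\<^sup>i\<^sup>) (t)\<close>; evaluating an
  operator on them reads off its coefficients.
\<close>

definition divpow :: "real \<Rightarrow> nat \<Rightarrow> density" where
  "divpow t p = smult (1 / fact p) ([:-t, 1:] ^ p)"

lemma pderiv_divpow: "pderiv (divpow t p) = (if p = 0 then 0 else divpow t (p - 1))"
  by (cases p) (auto simp: divpow_def pderiv_smult pderiv_power_Suc pderiv_pCons simp del: power_Suc)

lemma D_divpow: "D i (divpow t p) = (if i \<le> p then divpow t (p - i) else 0)"
  by (induction i) (auto simp: pderiv_divpow Suc_diff_le)

lemma poly_divpow: "poly (divpow t p) t = (if p = 0 then 1 else 0)"
  by (cases p) (auto simp: divpow_def)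

lemma poly_D_divpow: "poly (D i (divpow t p)) t = (if i = p then 1 else 0)"
  by (auto simp: D_divpow poly_divpow)

lemma poly_diffop_divpow:
  assumes "p + q + r \<le> k"
  shows "poly (diffop k \<alpha> (divpow t p) (divpow t q) (divpow t r)) t = poly (\<alpha> p q r) t"
proof -
  have fin: "finite {(i, j, l). i + j + l \<le> k}"
    by (rule finite_subset[of _ "{..k} \<times> {..k} \<times> {..k}"]) auto
  have "poly (diffop k \<alpha> (divpow t p) (divpow t q) (divpow t r)) t
      = (\<Sum>x \<in> {(i, j, l). i + j + l \<le> k}. if x = (p, q, r) then poly (\<alpha> p q r) t else 0)"
    unfolding diffop_def poly_sum
    by (rule sum.cong) (auto simp: poly_D_divpow split: if_splits)
  also have "\<dots> = poly (\<alpha> p q r) t"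
    using assms by (subst sum.delta[OF fin]) auto
  finally show ?thesis .
qed

lemma pderiv_diffop:
  "pderiv (diffop k \<alpha> a b c) = diffop k (\<lambda>i j l. pderiv (\<alpha> i j l)) a b c
    + diffop k \<alpha> (pderiv a) b c + diffop k \<alpha> a (pderiv b) c + diffop k \<alpha> a b (pderiv c)"
proof -
  have *: "D i (pderiv f) = pderiv (D i f)" for i and f :: density
    by (metis comp_apply funpow_Suc_right funpow.simps(2))
  have "pderiv (diffop k \<alpha> a b c) = (\<Sum>(i, j, l) \<in> {(i, j, l). i + j + l \<le> k}.
      pderiv (\<alpha> i j l * D i a * D j b * D l c))"
    unfolding diffop_def by (subst higher_pderiv_sum[of 1, simplified]) (auto intro!: sum.cong)
  then show ?thesis
    unfolding diffop_def sum.distrib[symmetric] by (auto intro!: sum.cong simp: * pderiv_mult algebra_simps)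
qed

lemma divpow_0: "divpow 0 n = monom (1 / fact n) n"
  unfolding divpow_def by (simp add: monom_altdef)

text \<open>
  At the origin divided powers are weight vectors: \<open>x^(s+1) d/dx\<close> shifts them by \<open>s\<close>. This is where the
  coefficients of the invariance equations come from.
\<close>

lemma Lie_divpow:
  "Lie w (monom 1 (s + 1)) (divpow 0 p) = smult (fact (p + s) / fact p * (real p + real (s + 1) * w)) (divpow 0 (p + s))"
proof -
  have "monom 1 (s + 1) * pderiv (divpow 0 p) = monom (real p / fact p) (p + s)"
    by (cases p) (simp_all add: divpow_0 pderiv_monom mult_monom add.commute)
  moreover have "smult w (pderiv (monom 1 (s + 1)) * divpow 0 p) = monom (w * real (s + 1) / fact p) (p + s)"
    by (simp add: divpow_0 pderiv_monom mult_monom smult_monom add.commute)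
  moreover have "smult (fact (p + s) / fact p * (real p + real (s + 1) * w)) (divpow 0 (p + s))
      = monom ((real p + real (s + 1) * w) / fact p) (p + s)"
    by (simp add: divpow_0 smult_monom)
  ultimately show ?thesis
    by (simp only: Lie_def add_monom) (simp add: field_simps)
qed

section \<open>The invariance equations\<close>

definition vf_coeff :: "nat \<Rightarrow> real \<Rightarrow> nat \<Rightarrow> real" where
  "vf_coeff s w n = fact (n + s) / fact n * (real n + real (s + 1) * w)"

text \<open>
  \<open>vf_act s lam \<gamma> \<tau> c i j l\<close> is the value at 0 of the right-hand side of the invariance condition for
  \<open>x^(s+1) d/dx\<close>, evaluated on divided powers of exponents \<open>i\<close>, \<open>j\<close>, \<open>l\<close>. The left-hand side vanishes
  at 0 for \<open>s \<ge> 1\<close>. In terms of the form \<open>P\<close>, it is a coefficient of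
  \<open>\<Sum> (x \<partial>\<^sub>x^(s+1) + (s + 1) lam \<partial>\<^sub>x^s) P\<close>, summed over the three variables.
\<close>

definition vf_act :: "nat \<Rightarrow> real \<Rightarrow> real \<Rightarrow> real \<Rightarrow> (nat \<Rightarrow> nat \<Rightarrow> nat \<Rightarrow> real) \<Rightarrow> nat \<Rightarrow> nat \<Rightarrow> nat \<Rightarrow> real" where
  "vf_act s lam \<gamma> \<tau> c i j l = vf_coeff s lam i * c (i + s) j l
     + vf_coeff s \<gamma> j * c i (j + s) l + vf_coeff s \<tau> l * c i j (l + s)"

definition inv_coeffs :: "real \<Rightarrow> real \<Rightarrow> real \<Rightarrow> (nat \<Rightarrow> nat \<Rightarrow> nat \<Rightarrow> real) \<Rightarrow> bool" where
  "inv_coeffs lam \<gamma> \<tau> c \<longleftrightarrow> (\<forall>s i j l. 1 \<le> s \<longrightarrow> i + j + l + s = 5 \<longrightarrow> vf_act s lam \<gamma> \<tau> c i j l = 0)"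

definition nonzero_coeffs :: "(nat \<Rightarrow> nat \<Rightarrow> nat \<Rightarrow> real) \<Rightarrow> bool" where
  "nonzero_coeffs c \<longleftrightarrow> (\<exists>i j l. i + j + l = 5 \<and> c i j l \<noteq> 0)"

lemma D_smult: "D n (smult x f) = smult x (D n f)"
  by (induction n) (auto simp: pderiv_smult)

lemma smult_sum: "smult x (sum f A) = (\<Sum>i\<in>A. smult x (f i))"
  by (induction A rule: infinite_finite_induct) (auto simp: smult_add_right)

lemma diffop_smult:
  "diffop k \<alpha> (smult x a) b c = smult x (diffop k \<alpha> a b c)"
  "diffop k \<alpha> a (smult x b) c = smult x (diffop k \<alpha> a b c)"
  "diffop k \<alpha> a b (smult x c) = smult x (diffop k \<alpha> a b c)"
  unfolding diffop_def by (auto simp: D_smult smult_sum intro!: sum.cong)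

text \<open>
  Translation invariance makes the coefficients constant, and invariance under \<open>x d/dx\<close> kills every
  coefficient whose total order differs from 5, because the weight of the values is
  \<open>lam + \<gamma> + \<tau> + 5\<close>.
\<close>

lemma invariant_diffop_coeffs:
  assumes "diffop_of_order 5 A" and inv: "vect_invariant lam \<gamma> \<tau> (lam + \<gamma> + \<tau> + 5) A"
  obtains c where "A = hom_op c" "inv_coeffs lam \<gamma> \<tau> c" "nonzero_coeffs c"
proof -
  obtain \<alpha> where A: "A = diffop 5 \<alpha>" and nz: "\<exists>i j l. i + j + l = 5 \<and> \<alpha> i j l \<noteq> 0"
    using assms(1) unfolding diffop_of_order_def by blast
  define \<mu> where "\<mu> = lam + \<gamma> + \<tau> + 5"
  have inv: "Lie \<mu> h (A a b d) = A (Lie lam h a) b d + A a (Lie \<gamma> h b) d + A a b (Lie \<tau> h d)" for h a b d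
    using inv unfolding vect_invariant_def \<mu>_def by blast
  \<comment> \<open>The field \<open>d/dx\<close>: differentiating the coefficients gives the zero operator.\<close>
  have const: "\<alpha> p q r = [:poly (\<alpha> p q r) 0:]" if "p + q + r \<le> 5" for p q r
  proof -
    have "diffop 5 (\<lambda>i j l. pderiv (\<alpha> i j l)) a b d = 0" for a b d
      using inv[of 1 a b d] pderiv_diffop[of 5 \<alpha> a b d] unfolding A by (simp add: Lie_def)
    then have "poly (pderiv (\<alpha> p q r)) t = 0" for t
      using poly_diffop_divpow[OF that, of "\<lambda>i j l. pderiv (\<alpha> i j l)" t] by simp
    then have "pderiv (\<alpha> p q r) = 0" by (intro poly_ext) simp
    then show ?thesis
      by (metis pderiv_iszero poly_pCons mult_zero_left add_0_right poly_0)
  qed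
  have at0: "poly (Lie \<mu> (monom 1 (s + 1)) (A (divpow 0 p) (divpow 0 q) (divpow 0 r))) 0
     = vf_coeff s lam p * poly (A (divpow 0 (p + s)) (divpow 0 q) (divpow 0 r)) 0
     + vf_coeff s \<gamma> q * poly (A (divpow 0 p) (divpow 0 (q + s)) (divpow 0 r)) 0
     + vf_coeff s \<tau> r * poly (A (divpow 0 p) (divpow 0 q) (divpow 0 (r + s))) 0" for s p q r
    unfolding inv Lie_divpow by (simp add: A diffop_smult vf_coeff_def)
  \<comment> \<open>The field \<open>x d/dx\<close>, that is, \<open>s = 0\<close>.\<close>
  have hom: "\<alpha> p q r = 0" if le: "p + q + r \<le> 5" and ne: "p + q + r \<noteq> 5" for p q r
  proof -
    have "\<mu> * poly (\<alpha> p q r) 0 = (p + lam + (q + \<gamma>) + (r + \<tau>)) * poly (\<alpha> p q r) 0"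
      using at0[of 0 p q r] unfolding A
      by (simp add: vf_coeff_def Lie_def poly_diffop_divpow[OF le] pderiv_monom poly_monom algebra_simps)
    then have "(5 - real (p + q + r)) * poly (\<alpha> p q r) 0 = 0"
      unfolding \<mu>_def by (simp add: algebra_simps)
    moreover have "5 - real (p + q + r) \<noteq> 0" using ne by linarith
    ultimately have "poly (\<alpha> p q r) 0 = 0" by simp
    with const[OF le] show ?thesis by simp
  qed
  define c where "c = (\<lambda>i j l. poly (\<alpha> i j l) 0)"
  have "A = hom_op c"
    unfolding A hom_op_def c_def
    by (intro ext) (auto simp: diffop_def intro!: sum.cong simp: hom simp flip: const)
  moreover have "inv_coeffs lam \<gamma> \<tau> c"
    unfolding inv_coeffs_def
  proof (intro allI impI)
    fix s i j l :: nat
    assume s: "1 \<le> s" and sum: "i + j + l + s = 5"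
    have "poly (Lie \<mu> (monom 1 (s + 1)) (A (divpow 0 i) (divpow 0 j) (divpow 0 l))) 0 = 0"
      using s by (simp add: Lie_def pderiv_monom poly_monom)
    then show "vf_act s lam \<gamma> \<tau> c i j l = 0"
      using at0[of s i j l] sum by (simp add: vf_act_def c_def A poly_diffop_divpow)
  qed
  moreover have "nonzero_coeffs c"
    using nz const unfolding nonzero_coeffs_def c_def by (metis order_refl pCons_0_0)
  ultimately show thesis by (rule that)
qed

section \<open>Permutations and dualizations\<close>

definition normal_form :: "real \<Rightarrow> real \<Rightarrow> real \<Rightarrow> (density \<Rightarrow> density \<Rightarrow> density \<Rightarrow> density) \<Rightarrow> bool" where
  "normal_form lam' \<gamma>' \<tau>' B \<longleftrightarrow>
    (lam' = 0 \<and> \<gamma>' = 0 \<and> \<tau>' = 0 \<and>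
       (\<exists>\<epsilon>1 \<epsilon>2. \<forall>\<phi> \<psi> chi. B \<phi> \<psi> chi =
          smult \<epsilon>1 (poisson 3 1 (poisson 1 1 (dR \<phi>) (dR \<psi>)) (dR chi)) +
          smult \<epsilon>2 (poisson 3 1 (poisson 1 1 (dR chi) (dR \<phi>)) (dR \<psi>)))
   \<or> lam' = 0 \<and> \<gamma>' = 0 \<and> \<tau>' = -2 \<and>
       (\<exists>\<epsilon>1 \<epsilon>2. \<forall>\<phi> \<psi> chi. B \<phi> \<psi> chi =
          smult \<epsilon>1 (poisson 1 1 (dR (poisson 1 (-2) (dR \<phi>) chi)) (dR \<psi>)) +
          smult \<epsilon>2 (poisson 1 1 (dR (poisson 1 (-2) (dR \<psi>) chi)) (dR \<phi>)))
   \<or> lam' = 0 \<and> \<gamma>' = 0 \<and> \<tau>' \<noteq> -4 \<and> \<tau>' \<noteq> -2 \<and> \<tau>' \<noteq> 0 \<and>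
       (\<exists>c. \<forall>\<phi> \<psi> chi. B \<phi> \<psi> chi = smult c (Delta3 1 1 \<tau>' (dR \<phi>) (dR \<psi>) chi))
   \<or> lam' = -2/3 \<and> \<gamma>' = -2/3 \<and> \<tau>' = 0 \<and>
       (\<exists>c. \<forall>\<phi> \<psi> chi. B \<phi> \<psi> chi = smult c (poisson (5/3) 1 (Gz \<phi> \<psi>) (dR chi)))
   \<or> lam' = -5/2 \<and> \<gamma>' = 0 \<and> \<tau>' = 1 \<and>
       (\<exists>c. \<forall>\<phi> \<psi> chi. B \<phi> \<psi> chi = smult c (Xi 1 \<phi> (dR \<psi>) chi))
   \<or> lam' = -2/3 \<and> \<gamma>' = -2/3 \<and> \<tau>' = -4/3 \<and>
       (\<exists>c. \<forall>\<phi> \<psi> chi. B \<phi> \<psi> chi = smult c (Gamma_op \<phi> \<psi> chi))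
   \<or> (\<exists>s \<in> {1, -1}. lam' = Theta_weight s \<and> \<gamma>' = Theta_weight s \<and> \<tau>' = Theta_weight s \<and>
       (\<exists>c. \<forall>\<phi> \<psi> chi. B \<phi> \<psi> chi = smult c (Theta s \<phi> \<psi> chi))))"

definition classified :: "real \<Rightarrow> real \<Rightarrow> real \<Rightarrow> (nat \<Rightarrow> nat \<Rightarrow> nat \<Rightarrow> real) \<Rightarrow> bool" where
  "classified lam \<gamma> \<tau> c \<longleftrightarrow> (\<exists>lam' \<gamma>' \<tau>' B.
     perm_dual (TernOp lam \<gamma> \<tau> (lam + \<gamma> + \<tau> + 5) (hom_op c))
               (TernOp lam' \<gamma>' \<tau>' (lam' + \<gamma>' + \<tau>' + 5) B) \<and> normal_form lam' \<gamma>' \<tau>' B)"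

lemma classifiedI: "normal_form lam \<gamma> \<tau> (hom_op c) \<Longrightarrow> classified lam \<gamma> \<tau> c"
  unfolding classified_def by blast

lemma classified_step:
  assumes "perm_dual_step (TernOp lam \<gamma> \<tau> (lam + \<gamma> + \<tau> + 5) (hom_op c))
             (TernOp lam' \<gamma>' \<tau>' (lam' + \<gamma>' + \<tau>' + 5) (hom_op c'))"
    and "classified lam' \<gamma>' \<tau>' c'"
  shows "classified lam \<gamma> \<tau> c"
  using assms unfolding classified_def by (meson converse_rtranclp_into_rtranclp)

definition swap12 :: "(nat \<Rightarrow> nat \<Rightarrow> nat \<Rightarrow> real) \<Rightarrow> nat \<Rightarrow> nat \<Rightarrow> nat \<Rightarrow> real" where
  "swap12 c i j l = c j i l"

definition swap23 :: "(nat \<Rightarrow> nat \<Rightarrow> nat \<Rightarrow> real) \<Rightarrow> nat \<Rightarrow> nat \<Rightarrow> nat \<Rightarrow> real" where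
  "swap23 c i j l = c i l j"

lemma hom_op_swap12: "hom_op (swap12 c) a b d = hom_op c b a d"
  unfolding hom_op_expand swap12_def by (simp add: mult_ac)

lemma hom_op_swap23: "hom_op (swap23 c) a b d = hom_op c a d b"
  unfolding hom_op_expand swap23_def by (simp add: mult_ac)

lemma classified_swap12: 
  assumes "classified \<gamma> lam \<tau> (swap12 c)" shows "classified lam \<gamma> \<tau> c"
proof (rule classified_step[OF _ assms])
  have "Transposition.transpose 0 1 permutes {..<3::nat}" by (rule permutes_swap_id) auto
  from perm[OF this, of "\<lambda>n. [lam, \<gamma>, \<tau>] ! n" "lam + \<gamma> + \<tau> + 5" "hom_op c"]
  show "perm_dual_step (TernOp lam \<gamma> \<tau> (lam + \<gamma> + \<tau> + 5) (hom_op c))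
     (TernOp \<gamma> lam \<tau> (\<gamma> + lam + \<tau> + 5) (hom_op (swap12 c)))"
    by (simp add: hom_op_swap12[abs_def] Transposition.transpose_def Let_def add_ac numeral_2_eq_2 fun_eq_iff cong: if_cong)
qed

lemma classified_swap23: 
  assumes "classified lam \<tau> \<gamma> (swap23 c)" shows "classified lam \<gamma> \<tau> c"
proof (rule classified_step[OF _ assms])
  have "Transposition.transpose 1 2 permutes {..<3::nat}" by (rule permutes_swap_id) auto
  from perm[OF this, of "\<lambda>n. [lam, \<gamma>, \<tau>] ! n" "lam + \<gamma> + \<tau> + 5" "hom_op c"]
  show "perm_dual_step (TernOp lam \<gamma> \<tau> (lam + \<gamma> + \<tau> + 5) (hom_op c))
     (TernOp lam \<tau> \<gamma> (lam + \<tau> + \<gamma> + 5) (hom_op (swap23 c)))"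
    by (simp add: hom_op_swap23[abs_def] Transposition.transpose_def Let_def add_ac numeral_2_eq_2 fun_eq_iff cong: if_cong)
qed

lemma inv_coeffs_swap12: "inv_coeffs lam \<gamma> \<tau> c \<Longrightarrow> inv_coeffs \<gamma> lam \<tau> (swap12 c)"
  unfolding inv_coeffs_def vf_act_def swap12_def by (auto simp: add_ac)

lemma inv_coeffs_swap23: "inv_coeffs lam \<gamma> \<tau> c \<Longrightarrow> inv_coeffs lam \<tau> \<gamma> (swap23 c)"
  unfolding inv_coeffs_def vf_act_def swap23_def by (auto simp: add_ac)

lemma nonzero_coeffs_swap12: "nonzero_coeffs c \<Longrightarrow> nonzero_coeffs (swap12 c)"
  unfolding nonzero_coeffs_def swap12_def by (metis add.commute)

lemma nonzero_coeffs_swap23: "nonzero_coeffs c \<Longrightarrow> nonzero_coeffs (swap23 c)"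
  unfolding nonzero_coeffs_def swap23_def by (metis add.commute add.left_commute)

text \<open>
  These are the coefficients of \<open>P(- x - y - z, y, z)\<close>: integration by parts moves all derivatives
  off the first slot onto the other three factors with a sign.
\<close>

definition dual :: "(nat \<Rightarrow> nat \<Rightarrow> nat \<Rightarrow> real) \<Rightarrow> nat \<Rightarrow> nat \<Rightarrow> nat \<Rightarrow> real" where
  "dual c i j l = (\<Sum>b\<le>j. \<Sum>d\<le>l. (-1) ^ (5 - b - d) *
     (fact (5 - b - d) / (fact i * fact (j - b) * fact (l - d))) * c (5 - b - d) b d)"

text \<open>
  The invariance equations in full. They are ordered by \<open>s = 1, \<dots>, 5\<close>, and for each \<open>s\<close> by descending
  exponents \<open>(i, j, l)\<close> with \<open>i + j + l = 5 - s\<close>: the equations for \<open>s = 1\<close> are those numbered 1 to 15, then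
  follow 16 to 25, 26 to 31, 32 to 34, and 35.
\<close>

lemma inv_coeffs_eqs:
  assumes "inv_coeffs lam \<gamma> \<tau> c"
  shows E1_400: "5 * (4 + 2 * lam) * c 5 0 0 + (2 * \<gamma>) * c 4 1 0 + (2 * \<tau>) * c 4 0 1 = 0"
    and E1_310: "4 * (3 + 2 * lam) * c 4 1 0 + 2 * (1 + 2 * \<gamma>) * c 3 2 0 + (2 * \<tau>) * c 3 1 1 = 0"
    and E1_301: "4 * (3 + 2 * lam) * c 4 0 1 + (2 * \<gamma>) * c 3 1 1 + 2 * (1 + 2 * \<tau>) * c 3 0 2 = 0"
    and E1_220: "3 * (2 + 2 * lam) * c 3 2 0 + 3 * (2 + 2 * \<gamma>) * c 2 3 0 + (2 * \<tau>) * c 2 2 1 = 0"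
    and E1_211: "3 * (2 + 2 * lam) * c 3 1 1 + 2 * (1 + 2 * \<gamma>) * c 2 2 1 + 2 * (1 + 2 * \<tau>) * c 2 1 2 = 0"
    and E1_202: "3 * (2 + 2 * lam) * c 3 0 2 + (2 * \<gamma>) * c 2 1 2 + 3 * (2 + 2 * \<tau>) * c 2 0 3 = 0"
    and E1_130: "2 * (1 + 2 * lam) * c 2 3 0 + 4 * (3 + 2 * \<gamma>) * c 1 4 0 + (2 * \<tau>) * c 1 3 1 = 0"
    and E1_121: "2 * (1 + 2 * lam) * c 2 2 1 + 3 * (2 + 2 * \<gamma>) * c 1 3 1 + 2 * (1 + 2 * \<tau>) * c 1 2 2 = 0"
    and E1_112: "2 * (1 + 2 * lam) * c 2 1 2 + 2 * (1 + 2 * \<gamma>) * c 1 2 2 + 3 * (2 + 2 * \<tau>) * c 1 1 3 = 0"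
    and E1_103: "2 * (1 + 2 * lam) * c 2 0 3 + (2 * \<gamma>) * c 1 1 3 + 4 * (3 + 2 * \<tau>) * c 1 0 4 = 0"
    and E1_040: "(2 * lam) * c 1 4 0 + 5 * (4 + 2 * \<gamma>) * c 0 5 0 + (2 * \<tau>) * c 0 4 1 = 0"
    and E1_031: "(2 * lam) * c 1 3 1 + 4 * (3 + 2 * \<gamma>) * c 0 4 1 + 2 * (1 + 2 * \<tau>) * c 0 3 2 = 0"
    and E1_022: "(2 * lam) * c 1 2 2 + 3 * (2 + 2 * \<gamma>) * c 0 3 2 + 3 * (2 + 2 * \<tau>) * c 0 2 3 = 0"
    and E1_013: "(2 * lam) * c 1 1 3 + 2 * (1 + 2 * \<gamma>) * c 0 2 3 + 4 * (3 + 2 * \<tau>) * c 0 1 4 = 0"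
    and E1_004: "(2 * lam) * c 1 0 4 + (2 * \<gamma>) * c 0 1 4 + 5 * (4 + 2 * \<tau>) * c 0 0 5 = 0"
    and E2_300: "20 * (3 + 3 * lam) * c 5 0 0 + 2 * (3 * \<gamma>) * c 3 2 0 + 2 * (3 * \<tau>) * c 3 0 2 = 0"
    and E2_210: "12 * (2 + 3 * lam) * c 4 1 0 + 6 * (1 + 3 * \<gamma>) * c 2 3 0 + 2 * (3 * \<tau>) * c 2 1 2 = 0"
    and E2_201: "12 * (2 + 3 * lam) * c 4 0 1 + 2 * (3 * \<gamma>) * c 2 2 1 + 6 * (1 + 3 * \<tau>) * c 2 0 3 = 0"
    and E2_120: "6 * (1 + 3 * lam) * c 3 2 0 + 12 * (2 + 3 * \<gamma>) * c 1 4 0 + 2 * (3 * \<tau>) * c 1 2 2 = 0"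
    and E2_111: "6 * (1 + 3 * lam) * c 3 1 1 + 6 * (1 + 3 * \<gamma>) * c 1 3 1 + 6 * (1 + 3 * \<tau>) * c 1 1 3 = 0"
    and E2_102: "6 * (1 + 3 * lam) * c 3 0 2 + 2 * (3 * \<gamma>) * c 1 2 2 + 12 * (2 + 3 * \<tau>) * c 1 0 4 = 0"
    and E2_030: "2 * (3 * lam) * c 2 3 0 + 20 * (3 + 3 * \<gamma>) * c 0 5 0 + 2 * (3 * \<tau>) * c 0 3 2 = 0"
    and E2_021: "2 * (3 * lam) * c 2 2 1 + 12 * (2 + 3 * \<gamma>) * c 0 4 1 + 6 * (1 + 3 * \<tau>) * c 0 2 3 = 0"
    and E2_012: "2 * (3 * lam) * c 2 1 2 + 6 * (1 + 3 * \<gamma>) * c 0 3 2 + 12 * (2 + 3 * \<tau>) * c 0 1 4 = 0"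
    and E2_003: "2 * (3 * lam) * c 2 0 3 + 2 * (3 * \<gamma>) * c 0 2 3 + 20 * (3 + 3 * \<tau>) * c 0 0 5 = 0"
    and E3_200: "60 * (2 + 4 * lam) * c 5 0 0 + 6 * (4 * \<gamma>) * c 2 3 0 + 6 * (4 * \<tau>) * c 2 0 3 = 0"
    and E3_110: "24 * (1 + 4 * lam) * c 4 1 0 + 24 * (1 + 4 * \<gamma>) * c 1 4 0 + 6 * (4 * \<tau>) * c 1 1 3 = 0"
    and E3_101: "24 * (1 + 4 * lam) * c 4 0 1 + 6 * (4 * \<gamma>) * c 1 3 1 + 24 * (1 + 4 * \<tau>) * c 1 0 4 = 0"
    and E3_020: "6 * (4 * lam) * c 3 2 0 + 60 * (2 + 4 * \<gamma>) * c 0 5 0 + 6 * (4 * \<tau>) * c 0 2 3 = 0"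
    and E3_011: "6 * (4 * lam) * c 3 1 1 + 24 * (1 + 4 * \<gamma>) * c 0 4 1 + 24 * (1 + 4 * \<tau>) * c 0 1 4 = 0"
    and E3_002: "6 * (4 * lam) * c 3 0 2 + 6 * (4 * \<gamma>) * c 0 3 2 + 60 * (2 + 4 * \<tau>) * c 0 0 5 = 0"
    and E4_100: "120 * (1 + 5 * lam) * c 5 0 0 + 24 * (5 * \<gamma>) * c 1 4 0 + 24 * (5 * \<tau>) * c 1 0 4 = 0"
    and E4_010: "24 * (5 * lam) * c 4 1 0 + 120 * (1 + 5 * \<gamma>) * c 0 5 0 + 24 * (5 * \<tau>) * c 0 1 4 = 0"
    and E4_001: "24 * (5 * lam) * c 4 0 1 + 24 * (5 * \<gamma>) * c 0 4 1 + 120 * (1 + 5 * \<tau>) * c 0 0 5 = 0"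
    and E5_000: "120 * (6 * lam) * c 5 0 0 + 120 * (6 * \<gamma>) * c 0 5 0 + 120 * (6 * \<tau>) * c 0 0 5 = 0"
proof -
  have *: "vf_act s lam \<gamma> \<tau> c i j l = 0" if "1 \<le> s" "i + j + l + s = 5" for s i j l
    using assms that unfolding inv_coeffs_def by blast
  show "5 * (4 + 2 * lam) * c 5 0 0 + (2 * \<gamma>) * c 4 1 0 + (2 * \<tau>) * c 4 0 1 = 0" using *[of 1 4 0 0] by (simp add: vf_act_def vf_coeff_def fact_numeral numeral_2_eq_2[symmetric])
  show "4 * (3 + 2 * lam) * c 4 1 0 + 2 * (1 + 2 * \<gamma>) * c 3 2 0 + (2 * \<tau>) * c 3 1 1 = 0" using *[of 1 3 1 0] by (simp add: vf_act_def vf_coeff_def fact_numeral numeral_2_eq_2[symmetric])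
  show "4 * (3 + 2 * lam) * c 4 0 1 + (2 * \<gamma>) * c 3 1 1 + 2 * (1 + 2 * \<tau>) * c 3 0 2 = 0" using *[of 1 3 0 1] by (simp add: vf_act_def vf_coeff_def fact_numeral numeral_2_eq_2[symmetric])
  show "3 * (2 + 2 * lam) * c 3 2 0 + 3 * (2 + 2 * \<gamma>) * c 2 3 0 + (2 * \<tau>) * c 2 2 1 = 0" using *[of 1 2 2 0] by (simp add: vf_act_def vf_coeff_def fact_numeral numeral_2_eq_2[symmetric])
  show "3 * (2 + 2 * lam) * c 3 1 1 + 2 * (1 + 2 * \<gamma>) * c 2 2 1 + 2 * (1 + 2 * \<tau>) * c 2 1 2 = 0" using *[of 1 2 1 1] by (simp add: vf_act_def vf_coeff_def fact_numeral numeral_2_eq_2[symmetric])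
  show "3 * (2 + 2 * lam) * c 3 0 2 + (2 * \<gamma>) * c 2 1 2 + 3 * (2 + 2 * \<tau>) * c 2 0 3 = 0" using *[of 1 2 0 2] by (simp add: vf_act_def vf_coeff_def fact_numeral numeral_2_eq_2[symmetric])
  show "2 * (1 + 2 * lam) * c 2 3 0 + 4 * (3 + 2 * \<gamma>) * c 1 4 0 + (2 * \<tau>) * c 1 3 1 = 0" using *[of 1 1 3 0] by (simp add: vf_act_def vf_coeff_def fact_numeral numeral_2_eq_2[symmetric])
  show "2 * (1 + 2 * lam) * c 2 2 1 + 3 * (2 + 2 * \<gamma>) * c 1 3 1 + 2 * (1 + 2 * \<tau>) * c 1 2 2 = 0" using *[of 1 1 2 1] by (simp add: vf_act_def vf_coeff_def fact_numeral numeral_2_eq_2[symmetric])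
  show "2 * (1 + 2 * lam) * c 2 1 2 + 2 * (1 + 2 * \<gamma>) * c 1 2 2 + 3 * (2 + 2 * \<tau>) * c 1 1 3 = 0" using *[of 1 1 1 2] by (simp add: vf_act_def vf_coeff_def fact_numeral numeral_2_eq_2[symmetric])
  show "2 * (1 + 2 * lam) * c 2 0 3 + (2 * \<gamma>) * c 1 1 3 + 4 * (3 + 2 * \<tau>) * c 1 0 4 = 0" using *[of 1 1 0 3] by (simp add: vf_act_def vf_coeff_def fact_numeral numeral_2_eq_2[symmetric])
  show "(2 * lam) * c 1 4 0 + 5 * (4 + 2 * \<gamma>) * c 0 5 0 + (2 * \<tau>) * c 0 4 1 = 0" using *[of 1 0 4 0] by (simp add: vf_act_def vf_coeff_def fact_numeral numeral_2_eq_2[symmetric])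
  show "(2 * lam) * c 1 3 1 + 4 * (3 + 2 * \<gamma>) * c 0 4 1 + 2 * (1 + 2 * \<tau>) * c 0 3 2 = 0" using *[of 1 0 3 1] by (simp add: vf_act_def vf_coeff_def fact_numeral numeral_2_eq_2[symmetric])
  show "(2 * lam) * c 1 2 2 + 3 * (2 + 2 * \<gamma>) * c 0 3 2 + 3 * (2 + 2 * \<tau>) * c 0 2 3 = 0" using *[of 1 0 2 2] by (simp add: vf_act_def vf_coeff_def fact_numeral numeral_2_eq_2[symmetric])
  show "(2 * lam) * c 1 1 3 + 2 * (1 + 2 * \<gamma>) * c 0 2 3 + 4 * (3 + 2 * \<tau>) * c 0 1 4 = 0" using *[of 1 0 1 3] by (simp add: vf_act_def vf_coeff_def fact_numeral numeral_2_eq_2[symmetric])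
  show "(2 * lam) * c 1 0 4 + (2 * \<gamma>) * c 0 1 4 + 5 * (4 + 2 * \<tau>) * c 0 0 5 = 0" using *[of 1 0 0 4] by (simp add: vf_act_def vf_coeff_def fact_numeral numeral_2_eq_2[symmetric])
  show "20 * (3 + 3 * lam) * c 5 0 0 + 2 * (3 * \<gamma>) * c 3 2 0 + 2 * (3 * \<tau>) * c 3 0 2 = 0" using *[of 2 3 0 0] by (simp add: vf_act_def vf_coeff_def fact_numeral numeral_2_eq_2[symmetric])
  show "12 * (2 + 3 * lam) * c 4 1 0 + 6 * (1 + 3 * \<gamma>) * c 2 3 0 + 2 * (3 * \<tau>) * c 2 1 2 = 0" using *[of 2 2 1 0] by (simp add: vf_act_def vf_coeff_def fact_numeral numeral_2_eq_2[symmetric])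
  show "12 * (2 + 3 * lam) * c 4 0 1 + 2 * (3 * \<gamma>) * c 2 2 1 + 6 * (1 + 3 * \<tau>) * c 2 0 3 = 0" using *[of 2 2 0 1] by (simp add: vf_act_def vf_coeff_def fact_numeral numeral_2_eq_2[symmetric])
  show "6 * (1 + 3 * lam) * c 3 2 0 + 12 * (2 + 3 * \<gamma>) * c 1 4 0 + 2 * (3 * \<tau>) * c 1 2 2 = 0" using *[of 2 1 2 0] by (simp add: vf_act_def vf_coeff_def fact_numeral numeral_2_eq_2[symmetric])
  show "6 * (1 + 3 * lam) * c 3 1 1 + 6 * (1 + 3 * \<gamma>) * c 1 3 1 + 6 * (1 + 3 * \<tau>) * c 1 1 3 = 0" using *[of 2 1 1 1] by (simp add: vf_act_def vf_coeff_def fact_numeral numeral_2_eq_2[symmetric])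
  show "6 * (1 + 3 * lam) * c 3 0 2 + 2 * (3 * \<gamma>) * c 1 2 2 + 12 * (2 + 3 * \<tau>) * c 1 0 4 = 0" using *[of 2 1 0 2] by (simp add: vf_act_def vf_coeff_def fact_numeral numeral_2_eq_2[symmetric])
  show "2 * (3 * lam) * c 2 3 0 + 20 * (3 + 3 * \<gamma>) * c 0 5 0 + 2 * (3 * \<tau>) * c 0 3 2 = 0" using *[of 2 0 3 0] by (simp add: vf_act_def vf_coeff_def fact_numeral numeral_2_eq_2[symmetric])
  show "2 * (3 * lam) * c 2 2 1 + 12 * (2 + 3 * \<gamma>) * c 0 4 1 + 6 * (1 + 3 * \<tau>) * c 0 2 3 = 0" using *[of 2 0 2 1] by (simp add: vf_act_def vf_coeff_def fact_numeral numeral_2_eq_2[symmetric])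
  show "2 * (3 * lam) * c 2 1 2 + 6 * (1 + 3 * \<gamma>) * c 0 3 2 + 12 * (2 + 3 * \<tau>) * c 0 1 4 = 0" using *[of 2 0 1 2] by (simp add: vf_act_def vf_coeff_def fact_numeral numeral_2_eq_2[symmetric])
  show "2 * (3 * lam) * c 2 0 3 + 2 * (3 * \<gamma>) * c 0 2 3 + 20 * (3 + 3 * \<tau>) * c 0 0 5 = 0" using *[of 2 0 0 3] by (simp add: vf_act_def vf_coeff_def fact_numeral numeral_2_eq_2[symmetric])
  show "60 * (2 + 4 * lam) * c 5 0 0 + 6 * (4 * \<gamma>) * c 2 3 0 + 6 * (4 * \<tau>) * c 2 0 3 = 0" using *[of 3 2 0 0] by (simp add: vf_act_def vf_coeff_def fact_numeral numeral_2_eq_2[symmetric])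
  show "24 * (1 + 4 * lam) * c 4 1 0 + 24 * (1 + 4 * \<gamma>) * c 1 4 0 + 6 * (4 * \<tau>) * c 1 1 3 = 0" using *[of 3 1 1 0] by (simp add: vf_act_def vf_coeff_def fact_numeral numeral_2_eq_2[symmetric])
  show "24 * (1 + 4 * lam) * c 4 0 1 + 6 * (4 * \<gamma>) * c 1 3 1 + 24 * (1 + 4 * \<tau>) * c 1 0 4 = 0" using *[of 3 1 0 1] by (simp add: vf_act_def vf_coeff_def fact_numeral numeral_2_eq_2[symmetric])
  show "6 * (4 * lam) * c 3 2 0 + 60 * (2 + 4 * \<gamma>) * c 0 5 0 + 6 * (4 * \<tau>) * c 0 2 3 = 0" using *[of 3 0 2 0] by (simp add: vf_act_def vf_coeff_def fact_numeral numeral_2_eq_2[symmetric])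
  show "6 * (4 * lam) * c 3 1 1 + 24 * (1 + 4 * \<gamma>) * c 0 4 1 + 24 * (1 + 4 * \<tau>) * c 0 1 4 = 0" using *[of 3 0 1 1] by (simp add: vf_act_def vf_coeff_def fact_numeral numeral_2_eq_2[symmetric])
  show "6 * (4 * lam) * c 3 0 2 + 6 * (4 * \<gamma>) * c 0 3 2 + 60 * (2 + 4 * \<tau>) * c 0 0 5 = 0" using *[of 3 0 0 2] by (simp add: vf_act_def vf_coeff_def fact_numeral numeral_2_eq_2[symmetric])
  show "120 * (1 + 5 * lam) * c 5 0 0 + 24 * (5 * \<gamma>) * c 1 4 0 + 24 * (5 * \<tau>) * c 1 0 4 = 0" using *[of 4 1 0 0] by (simp add: vf_act_def vf_coeff_def fact_numeral numeral_2_eq_2[symmetric])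
  show "24 * (5 * lam) * c 4 1 0 + 120 * (1 + 5 * \<gamma>) * c 0 5 0 + 24 * (5 * \<tau>) * c 0 1 4 = 0" using *[of 4 0 1 0] by (simp add: vf_act_def vf_coeff_def fact_numeral numeral_2_eq_2[symmetric])
  show "24 * (5 * lam) * c 4 0 1 + 24 * (5 * \<gamma>) * c 0 4 1 + 120 * (1 + 5 * \<tau>) * c 0 0 5 = 0" using *[of 4 0 0 1] by (simp add: vf_act_def vf_coeff_def fact_numeral numeral_2_eq_2[symmetric])
  show "120 * (6 * lam) * c 5 0 0 + 120 * (6 * \<gamma>) * c 0 5 0 + 120 * (6 * \<tau>) * c 0 0 5 = 0" using *[of 5 0 0 0] by (simp add: vf_act_def vf_coeff_def fact_numeral numeral_2_eq_2[symmetric])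
qed

lemma dual_values:
  shows "dual c 5 0 0 = - c 5 0 0"
    and "dual c 4 1 0 = - 5 * c 5 0 0 + c 4 1 0"
    and "dual c 4 0 1 = - 5 * c 5 0 0 + c 4 0 1"
    and "dual c 3 2 0 = - 10 * c 5 0 0 + 4 * c 4 1 0 - c 3 2 0"
    and "dual c 3 1 1 = - 20 * c 5 0 0 + 4 * c 4 0 1 + 4 * c 4 1 0 - c 3 1 1"
    and "dual c 3 0 2 = - 10 * c 5 0 0 + 4 * c 4 0 1 - c 3 0 2"
    and "dual c 2 3 0 = - 10 * c 5 0 0 + 6 * c 4 1 0 - 3 * c 3 2 0 + c 2 3 0"
    and "dual c 2 2 1 = - 30 * c 5 0 0 + 6 * c 4 0 1 + 12 * c 4 1 0 - 3 * c 3 1 1 - 3 * c 3 2 0 + c 2 2 1"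
    and "dual c 2 1 2 = - 30 * c 5 0 0 + 12 * c 4 0 1 - 3 * c 3 0 2 + 6 * c 4 1 0 - 3 * c 3 1 1 + c 2 1 2"
    and "dual c 2 0 3 = - 10 * c 5 0 0 + 6 * c 4 0 1 - 3 * c 3 0 2 + c 2 0 3"
    and "dual c 1 4 0 = - 5 * c 5 0 0 + 4 * c 4 1 0 - 3 * c 3 2 0 + 2 * c 2 3 0 - c 1 4 0"
    and "dual c 1 3 1 = - 20 * c 5 0 0 + 4 * c 4 0 1 + 12 * c 4 1 0 - 3 * c 3 1 1 - 6 * c 3 2 0 + 2 * c 2 2 1 + 2 * c 2 3 0 - c 1 3 1"
    and "dual c 1 2 2 = - 30 * c 5 0 0 + 12 * c 4 0 1 - 3 * c 3 0 2 + 12 * c 4 1 0 - 6 * c 3 1 1 + 2 * c 2 1 2 - 3 * c 3 2 0 + 2 * c 2 2 1 - c 1 2 2"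
    and "dual c 1 1 3 = - 20 * c 5 0 0 + 12 * c 4 0 1 - 6 * c 3 0 2 + 2 * c 2 0 3 + 4 * c 4 1 0 - 3 * c 3 1 1 + 2 * c 2 1 2 - c 1 1 3"
    and "dual c 1 0 4 = - 5 * c 5 0 0 + 4 * c 4 0 1 - 3 * c 3 0 2 + 2 * c 2 0 3 - c 1 0 4"
    and "dual c 0 5 0 = - c 5 0 0 + c 4 1 0 - c 3 2 0 + c 2 3 0 - c 1 4 0 + c 0 5 0"
    and "dual c 0 4 1 = - 5 * c 5 0 0 + c 4 0 1 + 4 * c 4 1 0 - c 3 1 1 - 3 * c 3 2 0 + c 2 2 1 + 2 * c 2 3 0 - c 1 3 1 - c 1 4 0 + c 0 4 1"
    and "dual c 0 3 2 = - 10 * c 5 0 0 + 4 * c 4 0 1 - c 3 0 2 + 6 * c 4 1 0 - 3 * c 3 1 1 + c 2 1 2 - 3 * c 3 2 0 + 2 * c 2 2 1 - c 1 2 2 + c 2 3 0 - c 1 3 1 + c 0 3 2"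
    and "dual c 0 2 3 = - 10 * c 5 0 0 + 6 * c 4 0 1 - 3 * c 3 0 2 + c 2 0 3 + 4 * c 4 1 0 - 3 * c 3 1 1 + 2 * c 2 1 2 - c 1 1 3 - c 3 2 0 + c 2 2 1 - c 1 2 2 + c 0 2 3"
    and "dual c 0 1 4 = - 5 * c 5 0 0 + 4 * c 4 0 1 - 3 * c 3 0 2 + 2 * c 2 0 3 - c 1 0 4 + c 4 1 0 - c 3 1 1 + c 2 1 2 - c 1 1 3 + c 0 1 4"
    and "dual c 0 0 5 = - c 5 0 0 + c 4 0 1 - c 3 0 2 + c 2 0 3 - c 1 0 4 + c 0 0 5"
  by (simp_all add: dual_def sum_atMost_numeral sum_atMost_numeral[simplified] fact_numeral)

text \<open>
  For \<open>Q(x, y, z) = P(- x - y - z, y, z)\<close>, the expression \<open>\<Sum> (x \<partial>\<^sub>x^(s+1) + \<dots>) Q\<close> with \<open>lam\<close>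
  replaced by \<open>\<rho>\<close> is a combination of the same substitution applied to \<open>x\<close>-derivatives of the
  corresponding expressions for \<open>P\<close> and exponents at most \<open>s\<close>; Euler's identity for the quintic \<open>P\<close>
  produces exactly the value \<open>- 4 - lam - \<gamma> - \<tau>\<close>. Coefficientwise, each equation for the dual is a
  linear combination of those quoted in its proof.
\<close>

lemma inv_coeffs_dual_eqs:
  assumes "inv_coeffs lam \<gamma> \<tau> c" and \<rho>: "\<rho> = - 4 - lam - \<gamma> - \<tau>"
  shows "5 * (4 + 2 * \<rho>) * dual c 5 0 0 + (2 * \<gamma>) * dual c 4 1 0 + (2 * \<tau>) * dual c 4 0 1 = 0"
    and "4 * (3 + 2 * \<rho>) * dual c 4 1 0 + 2 * (1 + 2 * \<gamma>) * dual c 3 2 0 + (2 * \<tau>) * dual c 3 1 1 = 0"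
    and "4 * (3 + 2 * \<rho>) * dual c 4 0 1 + (2 * \<gamma>) * dual c 3 1 1 + 2 * (1 + 2 * \<tau>) * dual c 3 0 2 = 0"
    and "3 * (2 + 2 * \<rho>) * dual c 3 2 0 + 3 * (2 + 2 * \<gamma>) * dual c 2 3 0 + (2 * \<tau>) * dual c 2 2 1 = 0"
    and "3 * (2 + 2 * \<rho>) * dual c 3 1 1 + 2 * (1 + 2 * \<gamma>) * dual c 2 2 1 + 2 * (1 + 2 * \<tau>) * dual c 2 1 2 = 0"
    and "3 * (2 + 2 * \<rho>) * dual c 3 0 2 + (2 * \<gamma>) * dual c 2 1 2 + 3 * (2 + 2 * \<tau>) * dual c 2 0 3 = 0"
    and "2 * (1 + 2 * \<rho>) * dual c 2 3 0 + 4 * (3 + 2 * \<gamma>) * dual c 1 4 0 + (2 * \<tau>) * dual c 1 3 1 = 0"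
    and "2 * (1 + 2 * \<rho>) * dual c 2 2 1 + 3 * (2 + 2 * \<gamma>) * dual c 1 3 1 + 2 * (1 + 2 * \<tau>) * dual c 1 2 2 = 0"
    and "2 * (1 + 2 * \<rho>) * dual c 2 1 2 + 2 * (1 + 2 * \<gamma>) * dual c 1 2 2 + 3 * (2 + 2 * \<tau>) * dual c 1 1 3 = 0"
    and "2 * (1 + 2 * \<rho>) * dual c 2 0 3 + (2 * \<gamma>) * dual c 1 1 3 + 4 * (3 + 2 * \<tau>) * dual c 1 0 4 = 0"
    and "(2 * \<rho>) * dual c 1 4 0 + 5 * (4 + 2 * \<gamma>) * dual c 0 5 0 + (2 * \<tau>) * dual c 0 4 1 = 0"
    and "(2 * \<rho>) * dual c 1 3 1 + 4 * (3 + 2 * \<gamma>) * dual c 0 4 1 + 2 * (1 + 2 * \<tau>) * dual c 0 3 2 = 0"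
    and "(2 * \<rho>) * dual c 1 2 2 + 3 * (2 + 2 * \<gamma>) * dual c 0 3 2 + 3 * (2 + 2 * \<tau>) * dual c 0 2 3 = 0"
    and "(2 * \<rho>) * dual c 1 1 3 + 2 * (1 + 2 * \<gamma>) * dual c 0 2 3 + 4 * (3 + 2 * \<tau>) * dual c 0 1 4 = 0"
    and "(2 * \<rho>) * dual c 1 0 4 + (2 * \<gamma>) * dual c 0 1 4 + 5 * (4 + 2 * \<tau>) * dual c 0 0 5 = 0"
    and "20 * (3 + 3 * \<rho>) * dual c 5 0 0 + 2 * (3 * \<gamma>) * dual c 3 2 0 + 2 * (3 * \<tau>) * dual c 3 0 2 = 0"
    and "12 * (2 + 3 * \<rho>) * dual c 4 1 0 + 6 * (1 + 3 * \<gamma>) * dual c 2 3 0 + 2 * (3 * \<tau>) * dual c 2 1 2 = 0"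
    and "12 * (2 + 3 * \<rho>) * dual c 4 0 1 + 2 * (3 * \<gamma>) * dual c 2 2 1 + 6 * (1 + 3 * \<tau>) * dual c 2 0 3 = 0"
    and "6 * (1 + 3 * \<rho>) * dual c 3 2 0 + 12 * (2 + 3 * \<gamma>) * dual c 1 4 0 + 2 * (3 * \<tau>) * dual c 1 2 2 = 0"
    and "6 * (1 + 3 * \<rho>) * dual c 3 1 1 + 6 * (1 + 3 * \<gamma>) * dual c 1 3 1 + 6 * (1 + 3 * \<tau>) * dual c 1 1 3 = 0"
    and "6 * (1 + 3 * \<rho>) * dual c 3 0 2 + 2 * (3 * \<gamma>) * dual c 1 2 2 + 12 * (2 + 3 * \<tau>) * dual c 1 0 4 = 0"
    and "2 * (3 * \<rho>) * dual c 2 3 0 + 20 * (3 + 3 * \<gamma>) * dual c 0 5 0 + 2 * (3 * \<tau>) * dual c 0 3 2 = 0"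
    and "2 * (3 * \<rho>) * dual c 2 2 1 + 12 * (2 + 3 * \<gamma>) * dual c 0 4 1 + 6 * (1 + 3 * \<tau>) * dual c 0 2 3 = 0"
    and "2 * (3 * \<rho>) * dual c 2 1 2 + 6 * (1 + 3 * \<gamma>) * dual c 0 3 2 + 12 * (2 + 3 * \<tau>) * dual c 0 1 4 = 0"
    and "2 * (3 * \<rho>) * dual c 2 0 3 + 2 * (3 * \<gamma>) * dual c 0 2 3 + 20 * (3 + 3 * \<tau>) * dual c 0 0 5 = 0"
    and "60 * (2 + 4 * \<rho>) * dual c 5 0 0 + 6 * (4 * \<gamma>) * dual c 2 3 0 + 6 * (4 * \<tau>) * dual c 2 0 3 = 0"
    and "24 * (1 + 4 * \<rho>) * dual c 4 1 0 + 24 * (1 + 4 * \<gamma>) * dual c 1 4 0 + 6 * (4 * \<tau>) * dual c 1 1 3 = 0"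
    and "24 * (1 + 4 * \<rho>) * dual c 4 0 1 + 6 * (4 * \<gamma>) * dual c 1 3 1 + 24 * (1 + 4 * \<tau>) * dual c 1 0 4 = 0"
    and "6 * (4 * \<rho>) * dual c 3 2 0 + 60 * (2 + 4 * \<gamma>) * dual c 0 5 0 + 6 * (4 * \<tau>) * dual c 0 2 3 = 0"
    and "6 * (4 * \<rho>) * dual c 3 1 1 + 24 * (1 + 4 * \<gamma>) * dual c 0 4 1 + 24 * (1 + 4 * \<tau>) * dual c 0 1 4 = 0"
    and "6 * (4 * \<rho>) * dual c 3 0 2 + 6 * (4 * \<gamma>) * dual c 0 3 2 + 60 * (2 + 4 * \<tau>) * dual c 0 0 5 = 0"
    and "120 * (1 + 5 * \<rho>) * dual c 5 0 0 + 24 * (5 * \<gamma>) * dual c 1 4 0 + 24 * (5 * \<tau>) * dual c 1 0 4 = 0"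
    and "24 * (5 * \<rho>) * dual c 4 1 0 + 120 * (1 + 5 * \<gamma>) * dual c 0 5 0 + 24 * (5 * \<tau>) * dual c 0 1 4 = 0"
    and "24 * (5 * \<rho>) * dual c 4 0 1 + 24 * (5 * \<gamma>) * dual c 0 4 1 + 120 * (1 + 5 * \<tau>) * dual c 0 0 5 = 0"
    and "120 * (6 * \<rho>) * dual c 5 0 0 + 120 * (6 * \<gamma>) * dual c 0 5 0 + 120 * (6 * \<tau>) * dual c 0 0 5 = 0"
proof -
  note E = inv_coeffs_eqs[OF assms(1)]
  show "5 * (4 + 2 * \<rho>) * dual c 5 0 0 + (2 * \<gamma>) * dual c 4 1 0 + (2 * \<tau>) * dual c 4 0 1 = 0"
    using E(1) unfolding dual_values \<rho> by algebra
  show "4 * (3 + 2 * \<rho>) * dual c 4 1 0 + 2 * (1 + 2 * \<gamma>) * dual c 3 2 0 + (2 * \<tau>) * dual c 3 1 1 = 0"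
    using E(1) E(2) unfolding dual_values \<rho> by algebra
  show "4 * (3 + 2 * \<rho>) * dual c 4 0 1 + (2 * \<gamma>) * dual c 3 1 1 + 2 * (1 + 2 * \<tau>) * dual c 3 0 2 = 0"
    using E(1) E(3) unfolding dual_values \<rho> by algebra
  show "3 * (2 + 2 * \<rho>) * dual c 3 2 0 + 3 * (2 + 2 * \<gamma>) * dual c 2 3 0 + (2 * \<tau>) * dual c 2 2 1 = 0"
    using E(1) E(2) E(4) unfolding dual_values \<rho> by algebra
  show "3 * (2 + 2 * \<rho>) * dual c 3 1 1 + 2 * (1 + 2 * \<gamma>) * dual c 2 2 1 + 2 * (1 + 2 * \<tau>) * dual c 2 1 2 = 0"
    using E(1) E(3) E(2) E(5) unfolding dual_values \<rho> by algebra
  show "3 * (2 + 2 * \<rho>) * dual c 3 0 2 + (2 * \<gamma>) * dual c 2 1 2 + 3 * (2 + 2 * \<tau>) * dual c 2 0 3 = 0"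
    using E(1) E(3) E(6) unfolding dual_values \<rho> by algebra
  show "2 * (1 + 2 * \<rho>) * dual c 2 3 0 + 4 * (3 + 2 * \<gamma>) * dual c 1 4 0 + (2 * \<tau>) * dual c 1 3 1 = 0"
    using E(1) E(2) E(4) E(7) unfolding dual_values \<rho> by algebra
  show "2 * (1 + 2 * \<rho>) * dual c 2 2 1 + 3 * (2 + 2 * \<gamma>) * dual c 1 3 1 + 2 * (1 + 2 * \<tau>) * dual c 1 2 2 = 0"
    using E(1) E(3) E(2) E(5) E(4) E(8) unfolding dual_values \<rho> by algebra
  show "2 * (1 + 2 * \<rho>) * dual c 2 1 2 + 2 * (1 + 2 * \<gamma>) * dual c 1 2 2 + 3 * (2 + 2 * \<tau>) * dual c 1 1 3 = 0"
    using E(1) E(3) E(6) E(2) E(5) E(9) unfolding dual_values \<rho> by algebra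
  show "2 * (1 + 2 * \<rho>) * dual c 2 0 3 + (2 * \<gamma>) * dual c 1 1 3 + 4 * (3 + 2 * \<tau>) * dual c 1 0 4 = 0"
    using E(1) E(3) E(6) E(10) unfolding dual_values \<rho> by algebra
  show "(2 * \<rho>) * dual c 1 4 0 + 5 * (4 + 2 * \<gamma>) * dual c 0 5 0 + (2 * \<tau>) * dual c 0 4 1 = 0"
    using E(1) E(2) E(4) E(7) E(11) unfolding dual_values \<rho> by algebra
  show "(2 * \<rho>) * dual c 1 3 1 + 4 * (3 + 2 * \<gamma>) * dual c 0 4 1 + 2 * (1 + 2 * \<tau>) * dual c 0 3 2 = 0"
    using E(1) E(3) E(2) E(5) E(4) E(8) E(7) E(12) unfolding dual_values \<rho> by algebra
  show "(2 * \<rho>) * dual c 1 2 2 + 3 * (2 + 2 * \<gamma>) * dual c 0 3 2 + 3 * (2 + 2 * \<tau>) * dual c 0 2 3 = 0"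
    using E(1) E(3) E(6) E(2) E(5) E(9) E(4) E(8) E(13) unfolding dual_values \<rho> by algebra
  show "(2 * \<rho>) * dual c 1 1 3 + 2 * (1 + 2 * \<gamma>) * dual c 0 2 3 + 4 * (3 + 2 * \<tau>) * dual c 0 1 4 = 0"
    using E(1) E(3) E(6) E(10) E(2) E(5) E(9) E(14) unfolding dual_values \<rho> by algebra
  show "(2 * \<rho>) * dual c 1 0 4 + (2 * \<gamma>) * dual c 0 1 4 + 5 * (4 + 2 * \<tau>) * dual c 0 0 5 = 0"
    using E(1) E(3) E(6) E(10) E(15) unfolding dual_values \<rho> by algebra
  show "20 * (3 + 3 * \<rho>) * dual c 5 0 0 + 2 * (3 * \<gamma>) * dual c 3 2 0 + 2 * (3 * \<tau>) * dual c 3 0 2 = 0"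
    using E(16) E(1) unfolding dual_values \<rho> by algebra
  show "12 * (2 + 3 * \<rho>) * dual c 4 1 0 + 6 * (1 + 3 * \<gamma>) * dual c 2 3 0 + 2 * (3 * \<tau>) * dual c 2 1 2 = 0"
    using E(16) E(17) E(1) E(2) unfolding dual_values \<rho> by algebra
  show "12 * (2 + 3 * \<rho>) * dual c 4 0 1 + 2 * (3 * \<gamma>) * dual c 2 2 1 + 6 * (1 + 3 * \<tau>) * dual c 2 0 3 = 0"
    using E(16) E(18) E(1) E(3) unfolding dual_values \<rho> by algebra
  show "6 * (1 + 3 * \<rho>) * dual c 3 2 0 + 12 * (2 + 3 * \<gamma>) * dual c 1 4 0 + 2 * (3 * \<tau>) * dual c 1 2 2 = 0"
    using E(16) E(17) E(19) E(1) E(2) E(4) unfolding dual_values \<rho> by algebra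
  show "6 * (1 + 3 * \<rho>) * dual c 3 1 1 + 6 * (1 + 3 * \<gamma>) * dual c 1 3 1 + 6 * (1 + 3 * \<tau>) * dual c 1 1 3 = 0"
    using E(16) E(18) E(17) E(20) E(1) E(3) E(2) E(5) unfolding dual_values \<rho> by algebra
  show "6 * (1 + 3 * \<rho>) * dual c 3 0 2 + 2 * (3 * \<gamma>) * dual c 1 2 2 + 12 * (2 + 3 * \<tau>) * dual c 1 0 4 = 0"
    using E(16) E(18) E(21) E(1) E(3) E(6) unfolding dual_values \<rho> by algebra
  show "2 * (3 * \<rho>) * dual c 2 3 0 + 20 * (3 + 3 * \<gamma>) * dual c 0 5 0 + 2 * (3 * \<tau>) * dual c 0 3 2 = 0"
    using E(16) E(17) E(19) E(22) E(1) E(2) E(4) E(7) unfolding dual_values \<rho> by algebra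
  show "2 * (3 * \<rho>) * dual c 2 2 1 + 12 * (2 + 3 * \<gamma>) * dual c 0 4 1 + 6 * (1 + 3 * \<tau>) * dual c 0 2 3 = 0"
    using E(16) E(18) E(17) E(20) E(19) E(23) E(1) E(3) E(2) E(5) E(4) E(8) unfolding dual_values \<rho> by algebra
  show "2 * (3 * \<rho>) * dual c 2 1 2 + 6 * (1 + 3 * \<gamma>) * dual c 0 3 2 + 12 * (2 + 3 * \<tau>) * dual c 0 1 4 = 0"
    using E(16) E(18) E(21) E(17) E(20) E(24) E(1) E(3) E(6) E(2) E(5) E(9) unfolding dual_values \<rho> by algebra
  show "2 * (3 * \<rho>) * dual c 2 0 3 + 2 * (3 * \<gamma>) * dual c 0 2 3 + 20 * (3 + 3 * \<tau>) * dual c 0 0 5 = 0"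
    using E(16) E(18) E(21) E(25) E(1) E(3) E(6) E(10) unfolding dual_values \<rho> by algebra
  show "60 * (2 + 4 * \<rho>) * dual c 5 0 0 + 6 * (4 * \<gamma>) * dual c 2 3 0 + 6 * (4 * \<tau>) * dual c 2 0 3 = 0"
    using E(26) E(16) E(1) unfolding dual_values \<rho> by algebra
  show "24 * (1 + 4 * \<rho>) * dual c 4 1 0 + 24 * (1 + 4 * \<gamma>) * dual c 1 4 0 + 6 * (4 * \<tau>) * dual c 1 1 3 = 0"
    using E(26) E(27) E(16) E(17) E(1) E(2) unfolding dual_values \<rho> by algebra
  show "24 * (1 + 4 * \<rho>) * dual c 4 0 1 + 6 * (4 * \<gamma>) * dual c 1 3 1 + 24 * (1 + 4 * \<tau>) * dual c 1 0 4 = 0"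
    using E(26) E(28) E(16) E(18) E(1) E(3) unfolding dual_values \<rho> by algebra
  show "6 * (4 * \<rho>) * dual c 3 2 0 + 60 * (2 + 4 * \<gamma>) * dual c 0 5 0 + 6 * (4 * \<tau>) * dual c 0 2 3 = 0"
    using E(26) E(27) E(29) E(16) E(17) E(19) E(1) E(2) E(4) unfolding dual_values \<rho> by algebra
  show "6 * (4 * \<rho>) * dual c 3 1 1 + 24 * (1 + 4 * \<gamma>) * dual c 0 4 1 + 24 * (1 + 4 * \<tau>) * dual c 0 1 4 = 0"
    using E(26) E(28) E(27) E(30) E(16) E(18) E(17) E(20) E(1) E(3) E(2) E(5) unfolding dual_values \<rho> by algebra
  show "6 * (4 * \<rho>) * dual c 3 0 2 + 6 * (4 * \<gamma>) * dual c 0 3 2 + 60 * (2 + 4 * \<tau>) * dual c 0 0 5 = 0"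
    using E(26) E(28) E(31) E(16) E(18) E(21) E(1) E(3) E(6) unfolding dual_values \<rho> by algebra
  show "120 * (1 + 5 * \<rho>) * dual c 5 0 0 + 24 * (5 * \<gamma>) * dual c 1 4 0 + 24 * (5 * \<tau>) * dual c 1 0 4 = 0"
    using E(32) E(26) E(16) E(1) unfolding dual_values \<rho> by algebra
  show "24 * (5 * \<rho>) * dual c 4 1 0 + 120 * (1 + 5 * \<gamma>) * dual c 0 5 0 + 24 * (5 * \<tau>) * dual c 0 1 4 = 0"
    using E(32) E(33) E(26) E(27) E(16) E(17) E(1) E(2) unfolding dual_values \<rho> by algebra
  show "24 * (5 * \<rho>) * dual c 4 0 1 + 24 * (5 * \<gamma>) * dual c 0 4 1 + 120 * (1 + 5 * \<tau>) * dual c 0 0 5 = 0"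
    using E(32) E(34) E(26) E(28) E(16) E(18) E(1) E(3) unfolding dual_values \<rho> by algebra
  show "120 * (6 * \<rho>) * dual c 5 0 0 + 120 * (6 * \<gamma>) * dual c 0 5 0 + 120 * (6 * \<tau>) * dual c 0 0 5 = 0"
    using E(35) E(32) E(26) E(16) E(1) unfolding dual_values \<rho> by algebra
qed

lemma all_atMost_numeral:
  fixes P :: "nat \<Rightarrow> bool"
  shows "(\<forall>i\<le>4. P i) \<longleftrightarrow> P 0 \<and> P 1 \<and> P 2 \<and> P 3 \<and> P 4"
    and "(\<forall>i\<le>3. P i) \<longleftrightarrow> P 0 \<and> P 1 \<and> P 2 \<and> P 3"
    and "(\<forall>i\<le>2. P i) \<longleftrightarrow> P 0 \<and> P 1 \<and> P 2"
    and "(\<forall>i\<le>1. P i) \<longleftrightarrow> P 0 \<and> P 1"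
  by (auto simp: eval_nat_numeral le_Suc_eq)

lemma inv_coeffs_dual:
  assumes "inv_coeffs lam \<gamma> \<tau> c" and \<rho>: "\<rho> = - 4 - lam - \<gamma> - \<tau>"
  shows "inv_coeffs \<rho> \<gamma> \<tau> (dual c)"
proof -
  note E = inv_coeffs_dual_eqs[OF assms]
  have "\<forall>s\<le>4. \<forall>i\<le>4 - s. \<forall>j\<le>4 - s - i. vf_act (s + 1) \<rho> \<gamma> \<tau> (dual c) i j (4 - s - i - j) = 0"
    unfolding all_atMost_numeral
    using E by (simp add: all_atMost_numeral[simplified] vf_act_def vf_coeff_def fact_numeral numeral_2_eq_2[symmetric]) (auto simp: field_simps)
  then have *: "vf_act (s + 1) \<rho> \<gamma> \<tau> (dual c) i j (4 - s - i - j) = 0" if "s \<le> 4" "i \<le> 4 - s" "j \<le> 4 - s - i" for s i j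
    using that by blast
  show ?thesis
    unfolding inv_coeffs_def
  proof (intro allI impI)
    fix s i j l :: nat
    assume "1 \<le> s" "i + j + l + s = 5"
    then have "s - 1 \<le> 4" "i \<le> 4 - (s - 1)" "j \<le> 4 - (s - 1) - i" "4 - (s - 1) - i - j = l" "s - 1 + 1 = s"
      by auto
    then show "vf_act s \<rho> \<gamma> \<tau> (dual c) i j l = 0"
      using *[of "s - 1" i j] by simp
  qed
qed

lemma order_5_cases:
  assumes "i + j + l = (5::nat)"
    and "P 5 0 0"
    and "P 4 1 0"
    and "P 4 0 1"
    and "P 3 2 0"
    and "P 3 1 1"
    and "P 3 0 2"
    and "P 2 3 0"
    and "P 2 2 1"
    and "P 2 1 2"
    and "P 2 0 3"
    and "P 1 4 0"
    and "P 1 3 1"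
    and "P 1 2 2"
    and "P 1 1 3"
    and "P 1 0 4"
    and "P 0 5 0"
    and "P 0 4 1"
    and "P 0 3 2"
    and "P 0 2 3"
    and "P 0 1 4"
    and "P 0 0 5"
  shows "P i j l"
proof -
  have "l = 5 - i - j" "i \<in> {0, 1, 2, 3, 4, 5}" "j \<in> {0, 1, 2, 3, 4, 5}" "i + j \<le> 5"
    using assms(1) by auto
  then show ?thesis using assms(2-) by auto
qed

text \<open>
  The substitution defining \<open>dual\<close> is invertible; on coefficients it is triangular, which makes the
  kernel visible.
\<close>

lemma nonzero_coeffs_dual:
  assumes "nonzero_coeffs c" shows "nonzero_coeffs (dual c)"
proof (rule ccontr)
  assume "\<not> nonzero_coeffs (dual c)"
  then have 0: "dual c i j l = 0" if "i + j + l = 5" for i j l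
    using that unfolding nonzero_coeffs_def by blast
  have "c i j l = 0" if "i + j + l = 5" for i j l
    using that
    apply (rule order_5_cases)
    subgoal using 0[of 5 0 0] unfolding dual_values by simp
    subgoal using 0[of 5 0 0] 0[of 4 1 0] unfolding dual_values by simp
    subgoal using 0[of 5 0 0] 0[of 4 0 1] unfolding dual_values by simp
    subgoal using 0[of 5 0 0] 0[of 4 1 0] 0[of 3 2 0] unfolding dual_values by simp
    subgoal using 0[of 5 0 0] 0[of 4 0 1] 0[of 4 1 0] 0[of 3 1 1] unfolding dual_values by simp
    subgoal using 0[of 5 0 0] 0[of 4 0 1] 0[of 3 0 2] unfolding dual_values by simp
    subgoal using 0[of 5 0 0] 0[of 4 1 0] 0[of 3 2 0] 0[of 2 3 0] unfolding dual_values by simp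
    subgoal using 0[of 5 0 0] 0[of 4 0 1] 0[of 4 1 0] 0[of 3 1 1] 0[of 3 2 0] 0[of 2 2 1] unfolding dual_values by simp
    subgoal using 0[of 5 0 0] 0[of 4 0 1] 0[of 3 0 2] 0[of 4 1 0] 0[of 3 1 1] 0[of 2 1 2] unfolding dual_values by simp
    subgoal using 0[of 5 0 0] 0[of 4 0 1] 0[of 3 0 2] 0[of 2 0 3] unfolding dual_values by simp
    subgoal using 0[of 5 0 0] 0[of 4 1 0] 0[of 3 2 0] 0[of 2 3 0] 0[of 1 4 0] unfolding dual_values by simp
    subgoal using 0[of 5 0 0] 0[of 4 0 1] 0[of 4 1 0] 0[of 3 1 1] 0[of 3 2 0] 0[of 2 2 1] 0[of 2 3 0] 0[of 1 3 1] unfolding dual_values by simp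
    subgoal using 0[of 5 0 0] 0[of 4 0 1] 0[of 3 0 2] 0[of 4 1 0] 0[of 3 1 1] 0[of 2 1 2] 0[of 3 2 0] 0[of 2 2 1] 0[of 1 2 2] unfolding dual_values by simp
    subgoal using 0[of 5 0 0] 0[of 4 0 1] 0[of 3 0 2] 0[of 2 0 3] 0[of 4 1 0] 0[of 3 1 1] 0[of 2 1 2] 0[of 1 1 3] unfolding dual_values by simp
    subgoal using 0[of 5 0 0] 0[of 4 0 1] 0[of 3 0 2] 0[of 2 0 3] 0[of 1 0 4] unfolding dual_values by simp
    subgoal using 0[of 5 0 0] 0[of 4 1 0] 0[of 3 2 0] 0[of 2 3 0] 0[of 1 4 0] 0[of 0 5 0] unfolding dual_values by simp
    subgoal using 0[of 5 0 0] 0[of 4 0 1] 0[of 4 1 0] 0[of 3 1 1] 0[of 3 2 0] 0[of 2 2 1] 0[of 2 3 0] 0[of 1 3 1] 0[of 1 4 0] 0[of 0 4 1] unfolding dual_values by simp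
    subgoal using 0[of 5 0 0] 0[of 4 0 1] 0[of 3 0 2] 0[of 4 1 0] 0[of 3 1 1] 0[of 2 1 2] 0[of 3 2 0] 0[of 2 2 1] 0[of 1 2 2] 0[of 2 3 0] 0[of 1 3 1] 0[of 0 3 2] unfolding dual_values by simp
    subgoal using 0[of 5 0 0] 0[of 4 0 1] 0[of 3 0 2] 0[of 2 0 3] 0[of 4 1 0] 0[of 3 1 1] 0[of 2 1 2] 0[of 1 1 3] 0[of 3 2 0] 0[of 2 2 1] 0[of 1 2 2] 0[of 0 2 3] unfolding dual_values by simp
    subgoal using 0[of 5 0 0] 0[of 4 0 1] 0[of 3 0 2] 0[of 2 0 3] 0[of 1 0 4] 0[of 4 1 0] 0[of 3 1 1] 0[of 2 1 2] 0[of 1 1 3] 0[of 0 1 4] unfolding dual_values by simp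
    subgoal using 0[of 5 0 0] 0[of 4 0 1] 0[of 3 0 2] 0[of 2 0 3] 0[of 1 0 4] 0[of 0 0 5] unfolding dual_values by simp
    done
  with assms show False unfolding nonzero_coeffs_def by blast
qed

text \<open>
  With scalar multiplication written as multiplication by a constant polynomial, identities between
  operators become identities of commutative rings.
\<close>

definition cst :: "real \<Rightarrow> real poly" where "cst x = [:x:]"

lemma smult_cst: "smult x p = cst x * p"
  by (simp add: cst_def)

lemma cst_simps:
  "cst (x + y) = cst x + cst y" "cst (x - y) = cst x - cst y" "cst (- x) = - cst x"
  "cst (x * y) = cst x * cst y" "cst 0 = 0" "cst 1 = 1" "cst (numeral n) = numeral n"
  by (simp_all add: cst_def numeral_poly one_pCons)

lemma adjoint1_hom_op:
  "adjoint1 5 (\<lambda>i j l. if i + j + l = 5 then [:c i j l:] else 0) = hom_op (dual c)"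
proof (intro ext)
  fix \<omega> \<psi> chi :: density
  show "adjoint1 5 (\<lambda>i j l. if i + j + l = 5 then [:c i j l:] else 0) \<omega> \<psi> chi = hom_op (dual c) \<omega> \<psi> chi"
    unfolding adj_sum hom_op_expand dual_values
    apply (simp add: sum_atMost_numeral sum_atMost_numeral[simplified]
       eval_nat_numeral pderiv_mult pderiv_add smult_cst cst_simps)
    apply (simp add: algebra_simps)
    done
qed

lemma classified_dual:
  assumes "classified (- 4 - lam - \<gamma> - \<tau>) \<gamma> \<tau> (dual c)"
  shows "classified lam \<gamma> \<tau> c"
proof (rule classified_step[OF _ assms])
  have e: "1 - (lam + \<gamma> + \<tau> + 5) = - 4 - lam - \<gamma> - \<tau>" "1 - lam = (- 4 - lam - \<gamma> - \<tau>) + \<gamma> + \<tau> + 5" by auto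
  show "perm_dual_step (TernOp lam \<gamma> \<tau> (lam + \<gamma> + \<tau> + 5) (hom_op c))
     (TernOp (- 4 - lam - \<gamma> - \<tau>) \<gamma> \<tau> (- 4 - lam - \<gamma> - \<tau> + \<gamma> + \<tau> + 5) (hom_op (dual c)))"
    using dual1[OF hom_op_def[of c], of lam \<gamma> \<tau> "lam + \<gamma> + \<tau> + 5"] unfolding adjoint1_hom_op e .
qed

section \<open>The listed operators as solutions of the equations\<close>

text \<open>
  At each of the following weights the invariance equations have an explicit solution space, of
  dimension two in the first two cases and one otherwise. The scalars of the normal form are found
  by comparing the coefficients that parametrize this space.
\<close>

lemma normal_form_0_0_0:
  assumes "inv_coeffs 0 0 0 c"
  shows "normal_form 0 0 0 (hom_op c)"
proof -
  note E = inv_coeffs_eqs[OF assms]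
  have v1: "c 5 0 0 = 0"
    using E(1) by algebra
  have v2: "c 4 1 0 = 0"
    using E(2, 4, 17) by algebra
  have v3: "c 4 0 1 = 0"
    using E(3, 6, 18) by algebra
  have v4: "c 3 2 0 = 0"
    using E(2, 4, 17) by algebra
  have v5: "c 3 0 2 = 0"
    using E(3, 6, 18) by algebra
  have v6: "c 2 3 0 = 0"
    using E(2, 4, 17) by algebra
  have v7: "c 2 1 2 = (-1) * c 2 2 1 + (-3) * c 3 1 1"
    using E(5) by algebra
  have v8: "c 2 0 3 = 0"
    using E(3, 6, 18) by algebra
  have v9: "c 1 4 0 = 0"
    using E(4, 7, 19) by algebra
  have v10: "c 1 3 1 = (-1/3) * c 2 2 1 + (-1) * c 3 1 1"
    using E(5, 8, 9, 20) by algebra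
  have v11: "c 1 2 2 = (3) * c 3 1 1"
    using E(5, 8, 9, 20) by algebra
  have v12: "c 1 1 3 = (1/3) * c 2 2 1"
    using E(5, 8, 9, 20) by algebra
  have v13: "c 1 0 4 = 0"
    using E(6, 10, 21) by algebra
  have v14: "c 0 5 0 = 0"
    using E(11) by algebra
  have v15: "c 0 4 1 = 0"
    using E(12, 13, 23) by algebra
  have v16: "c 0 3 2 = 0"
    using E(12, 13, 23) by algebra
  have v17: "c 0 2 3 = 0"
    using E(12, 13, 23) by algebra
  have v18: "c 0 1 4 = 0"
    using E(13, 14, 24) by algebra
  have v19: "c 0 0 5 = 0"
    using E(15) by algebra
  show ?thesis
    unfolding normal_form_def hom_op_expand v1 v2 v3 v4 v5 v6 v7 v8 v9 v10 v11 v12 v13 v14 v15 v16 v17 v18 v19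
    apply (rule disjI1, intro conjI refl)
    apply (rule exI[of _ "c 3 1 1 + c 2 2 1 / 3"], rule exI[of _ "c 2 2 1 / 3"], intro allI)
    by (rule poly_ext) (simp add: poisson_def dR_def eval_nat_numeral pderiv_mult pderiv_add pderiv_smult pderiv_diff pderiv_minus field_simps)
qed

lemma normal_form_0_0_neg2:
  assumes "inv_coeffs 0 0 (-2) c"
  shows "normal_form 0 0 (-2) (hom_op c)"
proof -
  note E = inv_coeffs_eqs[OF assms]
  have v1: "c 5 0 0 = 0"
    using E(1, 3, 16) by algebra
  have v2: "c 4 0 1 = 0"
    using E(1, 3, 16) by algebra
  have v3: "c 3 2 0 = (-1) * c 4 1 0"
    using E(2, 4, 5, 17) by algebra
  have v4: "c 3 1 1 = (5/2) * c 4 1 0"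
    using E(2, 4, 5, 17) by algebra
  have v5: "c 3 0 2 = 0"
    using E(1, 3, 16) by algebra
  have v6: "c 2 2 1 = (3/2) * c 2 3 0 + (-3/2) * c 4 1 0"
    using E(2, 4, 5, 17) by algebra
  have v7: "c 2 1 2 = (1/2) * c 2 3 0 + (2) * c 4 1 0"
    using E(17) by algebra
  have v8: "c 2 0 3 = 0"
    using E(3, 6, 18) by algebra
  have v9: "c 1 4 0 = (-1) * c 2 3 0"
    using E(4, 7, 8, 19) by algebra
  have v10: "c 1 3 1 = (-5/2) * c 2 3 0"
    using E(4, 7, 8, 19) by algebra
  have v11: "c 1 2 2 = (-2) * c 2 3 0 + (-1/2) * c 4 1 0"
    using E(2, 4, 8, 9, 17, 20) by algebra
  have v12: "c 1 1 3 = (-1/2) * c 2 3 0 + (1/2) * c 4 1 0"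
    using E(2, 4, 8, 9, 17, 20) by algebra
  have v13: "c 1 0 4 = 0"
    using E(6, 10, 21) by algebra
  have v14: "c 0 5 0 = 0"
    using E(11, 12, 22) by algebra
  have v15: "c 0 4 1 = 0"
    using E(11, 12, 22) by algebra
  have v16: "c 0 3 2 = 0"
    using E(11, 12, 22) by algebra
  have v17: "c 0 2 3 = 0"
    using E(12, 13, 23) by algebra
  have v18: "c 0 1 4 = 0"
    using E(13, 14, 24) by algebra
  have v19: "c 0 0 5 = 0"
    using E(25) by algebra
  show ?thesis
    unfolding normal_form_def hom_op_expand v1 v2 v3 v4 v5 v6 v7 v8 v9 v10 v11 v12 v13 v14 v15 v16 v17 v18 v19
    apply (rule disjI2, rule disjI1, intro conjI refl)
    apply (rule exI[of _ "- c 4 1 0 / 2"], rule exI[of _ "c 2 3 0 / 2"], intro allI)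
    by (rule poly_ext) (simp add: poisson_def dR_def eval_nat_numeral pderiv_mult pderiv_add pderiv_smult pderiv_diff pderiv_minus field_simps)
qed

lemma normal_form_Gz:
  assumes "inv_coeffs (-2/3) (-2/3) 0 c"
  shows "normal_form (-2/3) (-2/3) 0 (hom_op c)"
proof -
  note E = inv_coeffs_eqs[OF assms]
  have v1: "c 5 0 0 = 0"
    using E(16, 19) by algebra
  have v2: "c 4 1 0 = 0"
    using E(2, 19) by algebra
  have v3: "c 3 2 0 = 0"
    using E(19) by algebra
  have v4: "c 3 1 1 = (5/2) * c 4 0 1"
    using E(3, 5, 8, 9, 10, 18, 20, 21) by algebra
  have v5: "c 3 0 2 = (-5/3) * c 4 0 1"
    using E(3, 5, 8, 9, 10, 18, 20, 21) by algebra
  have v6: "c 2 3 0 = 0"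
    using E(17) by algebra
  have v7: "c 2 2 1 = 0"
    using E(5, 6, 8, 9, 10, 18, 20, 21) by algebra
  have v8: "c 2 1 2 = (-5/2) * c 4 0 1"
    using E(3, 5, 6, 8, 9, 10, 18, 20, 21) by algebra
  have v9: "c 2 0 3 = 0"
    using E(5, 6, 8, 9, 10, 18, 20, 21) by algebra
  have v10: "c 1 4 0 = 0"
    using E(7, 17) by algebra
  have v11: "c 1 3 1 = (-5/2) * c 4 0 1"
    using E(3, 5, 6, 8, 9, 10, 18, 20, 21) by algebra
  have v12: "c 1 2 2 = (5/2) * c 4 0 1"
    using E(3, 5, 6, 8, 9, 10, 18, 20, 21) by algebra
  have v13: "c 1 1 3 = 0"
    using E(5, 6, 8, 9, 10, 18, 20, 21) by algebra
  have v14: "c 1 0 4 = 0"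
    using E(5, 6, 8, 9, 10, 18, 20, 21) by algebra
  have v15: "c 0 5 0 = 0"
    using E(17, 22) by algebra
  have v16: "c 0 4 1 = (-1) * c 4 0 1"
    using E(3, 5, 6, 8, 9, 10, 12, 13, 18, 20, 21, 23) by algebra
  have v17: "c 0 3 2 = (5/3) * c 4 0 1"
    using E(3, 5, 6, 8, 9, 10, 13, 18, 20, 21, 23) by algebra
  have v18: "c 0 2 3 = 0"
    using E(5, 8, 9, 13, 14, 20, 23, 24) by algebra
  have v19: "c 0 1 4 = 0"
    using E(5, 8, 9, 13, 14, 20, 23, 24) by algebra
  have v20: "c 0 0 5 = 0"
    using E(6, 9, 10, 14, 15, 18, 21, 23, 25) by algebra
  show ?thesis
    unfolding normal_form_def hom_op_expand v1 v2 v3 v4 v5 v6 v7 v8 v9 v10 v11 v12 v13 v14 v15 v16 v17 v18 v19 v20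
    apply (rule disjI2, rule disjI2, rule disjI2, rule disjI1, intro conjI, simp, simp, simp)
    apply (rule exI[of _ "c 4 0 1 / 2"], intro allI)
    by (rule poly_ext) (simp add: poisson_def dR_def Gz_def eval_nat_numeral pderiv_mult pderiv_add pderiv_smult pderiv_diff pderiv_minus field_simps)
qed

lemma normal_form_Xi:
  assumes "inv_coeffs (-5/2) 0 1 c"
  shows "normal_form (-5/2) 0 1 (hom_op c)"
proof -
  note E = inv_coeffs_eqs[OF assms]
  have v1: "c 5 0 0 = 0"
    using E(1, 3, 16) by algebra
  have v2: "c 4 1 0 = 0"
    using E(2, 4, 5, 7, 8, 11, 12, 13, 17, 19, 22, 23) by algebra
  have v3: "c 4 0 1 = 0"
    using E(1, 3, 16) by algebra
  have v4: "c 3 1 1 = (-1) * c 3 2 0"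
    using E(2, 4, 5, 7, 8, 11, 12, 13, 17, 19, 22, 23) by algebra
  have v5: "c 3 0 2 = 0"
    using E(1, 3, 16) by algebra
  have v6: "c 2 3 0 = (3/2) * c 3 2 0"
    using E(4, 7, 8, 11, 12, 13, 19, 22, 23) by algebra
  have v7: "c 2 2 1 = 0"
    using E(4, 7, 8, 11, 12, 13, 19, 22, 23) by algebra
  have v8: "c 2 1 2 = (-3/2) * c 3 2 0"
    using E(2, 4, 5, 7, 8, 11, 12, 13, 17, 19, 22, 23) by algebra
  have v9: "c 2 0 3 = 0"
    using E(10, 15, 25) by algebra
  have v10: "c 1 4 0 = (5/4) * c 3 2 0"
    using E(4, 7, 8, 11, 12, 13, 19, 22, 23) by algebra
  have v11: "c 1 3 1 = (-3/2) * c 3 2 0"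
    using E(4, 7, 8, 11, 12, 13, 19, 22, 23) by algebra
  have v12: "c 1 2 2 = (3/2) * c 3 2 0"
    using E(4, 7, 8, 11, 12, 13, 19, 22, 23) by algebra
  have v13: "c 1 1 3 = (-5/4) * c 3 2 0"
    using E(2, 4, 5, 8, 9, 12, 13, 14, 17, 20, 23, 24) by algebra
  have v14: "c 1 0 4 = 0"
    using E(10, 15, 25) by algebra
  have v15: "c 0 5 0 = (3/8) * c 3 2 0"
    using E(4, 7, 8, 11, 12, 13, 19, 22, 23) by algebra
  have v16: "c 0 4 1 = (-5/8) * c 3 2 0"
    using E(4, 7, 8, 11, 12, 13, 19, 22, 23) by algebra
  have v17: "c 0 3 2 = 0"
    using E(4, 7, 8, 11, 12, 13, 19, 22, 23) by algebra
  have v18: "c 0 2 3 = (5/8) * c 3 2 0"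
    using E(4, 7, 8, 11, 12, 13, 19, 22, 23) by algebra
  have v19: "c 0 1 4 = (-3/8) * c 3 2 0"
    using E(4, 5, 7, 8, 9, 12, 13, 14, 19, 20, 23, 24) by algebra
  have v20: "c 0 0 5 = 0"
    using E(10, 15, 25) by algebra
  show ?thesis
    unfolding normal_form_def hom_op_expand v1 v2 v3 v4 v5 v6 v7 v8 v9 v10 v11 v12 v13 v14 v15 v16 v17 v18 v19 v20
    apply (rule disjI2, rule disjI2, rule disjI2, rule disjI2, rule disjI1, intro conjI, simp, simp, simp)
    apply (rule exI[of _ "- 3 / 40 * c 3 2 0"], intro allI)
    by (rule poly_ext) (simp add: dR_def Xi_def op_of_coeffs_def eval_nat_numeral pderiv_mult pderiv_add pderiv_smult pderiv_diff pderiv_minus field_simps)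
qed

lemma normal_form_Gamma:
  assumes "inv_coeffs (-2/3) (-2/3) (-4/3) c"
  shows "normal_form (-2/3) (-2/3) (-4/3) (hom_op c)"
proof -
  note E = inv_coeffs_eqs[OF assms]
  have v1: "c 4 1 0 = (3/2) * c 5 0 0"
    using E(2, 4, 5, 6, 16, 17, 18) by algebra
  have v2: "c 4 0 1 = (17/4) * c 5 0 0"
    using E(1, 2, 4, 5, 6, 16, 17, 18) by algebra
  have v3: "c 3 2 0 = (-15/2) * c 5 0 0"
    using E(1, 2, 3, 4, 5, 6, 16, 17, 18) by algebra
  have v4: "c 3 1 1 = (45/8) * c 5 0 0"
    using E(1, 2, 3, 4, 5, 6, 16, 17, 18) by algebra
  have v5: "c 3 0 2 = (25/4) * c 5 0 0"
    using E(1, 2, 3, 4, 5, 6, 16, 17, 18) by algebra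
  have v6: "c 2 3 0 = (-15/2) * c 5 0 0"
    using E(1, 2, 3, 4, 5, 6, 16, 17, 18) by algebra
  have v7: "c 2 2 1 = (-45/4) * c 5 0 0"
    using E(1, 2, 3, 4, 5, 6, 16, 17, 18) by algebra
  have v8: "c 2 1 2 = (45/8) * c 5 0 0"
    using E(1, 2, 3, 4, 5, 6, 16, 17, 18) by algebra
  have v9: "c 2 0 3 = (5/2) * c 5 0 0"
    using E(1, 2, 3, 4, 5, 6, 16, 17, 18) by algebra
  have v10: "c 1 4 0 = (3/2) * c 5 0 0"
    using E(1, 2, 3, 4, 5, 6, 7, 8, 16, 17, 18, 19) by algebra
  have v11: "c 1 3 1 = (45/8) * c 5 0 0"
    using E(1, 2, 3, 4, 5, 6, 8, 16, 17, 18, 19) by algebra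
  have v12: "c 1 2 2 = (45/8) * c 5 0 0"
    using E(1, 2, 3, 4, 5, 6, 16, 17, 18, 19) by algebra
  have v13: "c 1 1 3 = (-15/4) * c 5 0 0"
    using E(1, 2, 3, 5, 9, 10, 16, 18, 19, 21) by algebra
  have v14: "c 1 0 4 = (-5/2) * c 5 0 0"
    using E(1, 2, 3, 4, 5, 6, 16, 17, 18, 19, 21) by algebra
  have v15: "c 0 5 0 = (1) * c 5 0 0"
    using E(4, 6, 7, 8, 11, 12, 13, 16, 17, 18, 19, 22, 23) by algebra
  have v16: "c 0 4 1 = (17/4) * c 5 0 0"
    using E(4, 6, 7, 8, 11, 12, 13, 16, 17, 18, 19, 22, 23) by algebra
  have v17: "c 0 3 2 = (25/4) * c 5 0 0"
    using E(1, 2, 3, 4, 5, 6, 13, 16, 17, 18, 19, 23) by algebra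
  have v18: "c 0 2 3 = (5/2) * c 5 0 0"
    using E(1, 2, 3, 4, 5, 6, 16, 17, 18, 23) by algebra
  have v19: "c 0 1 4 = (-5/2) * c 5 0 0"
    using E(1, 2, 3, 4, 5, 15, 16, 17, 18, 19, 21, 23, 25) by algebra
  have v20: "c 0 0 5 = (-1) * c 5 0 0"
    using E(1, 2, 3, 4, 5, 6, 16, 17, 18, 23, 25) by algebra
  show ?thesis
    unfolding normal_form_def hom_op_expand v1 v2 v3 v4 v5 v6 v7 v8 v9 v10 v11 v12 v13 v14 v15 v16 v17 v18 v19 v20
    apply (rule disjI2, rule disjI2, rule disjI2, rule disjI2, rule disjI2, rule disjI1, intro conjI, simp, simp, simp)
    apply (rule exI[of _ "- 5 / 2 * c 5 0 0"], intro allI)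
    by (rule poly_ext) (simp add: dR_def Gamma_op_def op_of_coeffs_def eval_nat_numeral pderiv_mult pderiv_add pderiv_smult pderiv_diff pderiv_minus field_simps)
qed

text \<open>
  The quadratic equation says that \<open>k\<close> is one of the two values \<open>- (9 \<plusminus> sqrt 21) / 12\<close>. Over the field
  generated by \<open>k\<close> the equations have a one-dimensional space of solutions, all antisymmetric, and
  \<open>- 26 - 24 k\<close> is the coefficient \<open>2 (\<plusminus> sqrt 21 - 4)\<close> of the second determinant.
\<close>

lemma normal_form_Theta:
  assumes "inv_coeffs k k k c" and k: "12 * k^2 + 18 * k + 5 = 0"
  shows "normal_form k k k (hom_op c)"
proof -
  note E = inv_coeffs_eqs[OF assms(1)]
  have v1: "c 0 2 3 = (- 26 - 24 * k) * c 0 1 4"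
    using E(6, 9, 10, 13, 14, 21, 24)  k by algebra
  have v2: "c 1 1 3 = 0"
    using E(14) v1 k by algebra
  have v3: "c 0 0 5 = 0"
    using E(10, 15, 25) v2 v1 k by algebra
  have v4: "c 1 0 4 = - c 0 1 4"
    using E(15) v3 k by algebra
  have v5: "c 2 0 3 = - (- 26 - 24 * k) * c 0 1 4"
    using E(10) v4 v2 k by algebra
  have v6: "c 0 3 2 = - (- 26 - 24 * k) * c 0 1 4"
    using E(9, 13, 24) v2 v1 k by algebra
  have v7: "c 1 2 2 = 0"
    using E(13) v6 v1 k by algebra
  have v8: "c 2 1 2 = 0"
    using E(24) v6 k by algebra
  have v9: "c 3 0 2 = (- 26 - 24 * k) * c 0 1 4"
    using E(6) v8 v5 k by algebra
  have v10: "c 1 3 1 = 0"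
    using E(4, 7, 8, 19) v7 k by algebra
  have v11: "c 0 4 1 = - c 0 1 4"
    using E(12) v10 v6 k by algebra
  have v12: "c 2 2 1 = 0"
    using E(23) v11 v1 k by algebra
  have v13: "c 3 1 1 = 0"
    using E(20) v10 v2 k by algebra
  have v14: "c 4 0 1 = c 0 1 4"
    using E(18) v12 v5 k by algebra
  have v15: "c 1 4 0 = c 0 1 4"
    using E(7, 11, 22) v10 v11 v6 k by algebra
  have v16: "c 0 5 0 = 0"
    using E(11) v15 v11 k by algebra
  have v17: "c 2 3 0 = (- 26 - 24 * k) * c 0 1 4"
    using E(7) v15 v10 k by algebra
  have v18: "c 3 2 0 = - (- 26 - 24 * k) * c 0 1 4"
    using E(4) v17 v12 k by algebra
  have v19: "c 4 1 0 = - c 0 1 4"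
    using E(2) v18 v13 k by algebra
  have v20: "c 5 0 0 = 0"
    using E(1) v14 v19 k by algebra
  \<comment> \<open>The sign \<open>s\<close> of the square root is read off from \<open>12 k + 9 = - s sqrt 21\<close>.\<close>
  have "(12 * k + 9)\<^sup>2 = 21"
    using k by algebra
  then have "\<bar>12 * k + 9\<bar> = sqrt 21"
    by (metis real_sqrt_abs)
  then obtain s :: real where s: "s \<in> {1, -1}" "s * sqrt 21 = - (12 * k + 9)"
    by (metis abs_if insert_iff minus_minus mult_1 mult_minus1)
  have w: "k = Theta_weight s"
    unfolding Theta_weight_def s by simp
  have det: "det (vector [vector [a, b, c], vector [d, e, f], vector [g, h, i]] :: real poly ^ 3 ^ 3)
     = a * e * i + b * f * g + c * d * h - a * f * h - b * d * i - c * e * g" for a b c d e f g h i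
    by (simp add: det_3)
  have "hom_op c \<phi> \<psi> chi = smult (c 0 1 4) (Theta s \<phi> \<psi> chi)" for \<phi> \<psi> chi
    unfolding hom_op_expand v1 v2 v3 v4 v5 v6 v7 v8 v9 v10 v11 v12 v13 v14 v15 v16 v17 v18 v19 v20 Theta_def det s(2)
    by (rule poly_ext) (simp add: eval_nat_numeral algebra_simps)
  with s(1) w show ?thesis
    unfolding normal_form_def by blast
qed

text \<open>
  With two vanishing weights the form is divisible by \<open>x y\<close>. Eliminating the other coefficients gives
  \<open>\<tau> (\<tau> + 2) (\<tau> + 4) c 1 1 3 = 0\<close>; once \<open>c 1 1 3 = 0\<close>, the coefficients are found one after the other as
  multiples of \<open>c 2 1 2\<close>.
\<close>

lemma normal_form_Delta3:
  assumes "inv_coeffs 0 0 \<tau> c" and \<tau>: "\<tau> \<noteq> - 4" "\<tau> \<noteq> - 2" "\<tau> \<noteq> 0"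
  shows "normal_form 0 0 \<tau> (hom_op c)"
proof -
  note E = inv_coeffs_eqs[OF assms(1)]
  have z: "c 0 0 5 = 0" using E(15) E(25) by algebra
  \<comment> \<open>No term is free of derivatives of \<open>\<phi>\<close>, and none is free of derivatives of \<open>\<psi>\<close>.\<close>
  have z0: "c 0 1 4 = 0" "c 0 2 3 = 0" "c 0 3 2 = 0" "c 0 4 1 = 0" "c 0 5 0 = 0"
    using E(12-14) E(22-25) E(30) E(29) E(31) z by algebra+
  have z1: "c 1 0 4 = 0" "c 2 0 3 = 0" "c 3 0 2 = 0" "c 4 0 1 = 0" "c 5 0 0 = 0"
    using E(3) E(6) E(10) E(16) E(18) E(21) E(25) E(26) E(28) E(31) z by algebra+
  have "\<tau> * (\<tau> + 2) * (\<tau> + 4) * c 1 1 3 = 0"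
    using E(2) E(4) E(5) E(7) E(8) E(9) E(17) E(19) E(20) by algebra
  then have c113: "c 1 1 3 = 0" using \<tau> by (simp add: add_eq_0_iff)
  \<comment> \<open>The operator \<open>Delta3 1 1 \<tau>\<close> has coefficient \<open>15 (\<tau> + 2)\<close> at exponents \<open>(1, 0, 2)\<close>.\<close>
  define e where "e = c 2 1 2 / (15 * (\<tau> + 2))"
  have c212: "c 2 1 2 = 15 * (\<tau> + 2) * e" using \<tau> by (simp add: e_def add_eq_0_iff)
  have c122: "c 1 2 2 = - 15 * (\<tau> + 2) * e"
    using E(9) c113 c212 by algebra
  have c221: "c 2 2 1 = 0"
    using E(5) E(8) E(20) c113 c212 c122 by algebra
  have c131: "c 1 3 1 = 5 * (\<tau> + 2) * (1 + 2 * \<tau>) * e"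
    using E(8) c221 c122 by algebra
  have c311: "c 3 1 1 = - 5 * (\<tau> + 2) * (1 + 2 * \<tau>) * e"
    using E(5) c221 c212 by algebra
  have c140: "c 1 4 0 = \<tau> * (1 - \<tau>) * (\<tau> + 2) * e"
    using E(2) E(4) E(7) E(17) E(19) c221 c131 c311 c122 c212 by algebra
  have c410: "c 4 1 0 = \<tau> * (\<tau> - 1) * (\<tau> + 2) * e"
    using E(2) E(4) E(7) E(17) E(19) c221 c131 c311 c122 c212 by algebra
  have c230: "c 2 3 0 = - \<tau> * (\<tau> + 2) * (11 + 4 * \<tau>) * e"
    using E(7) c140 c131 by algebra
  have c320: "c 3 2 0 = \<tau> * (\<tau> + 2) * (11 + 4 * \<tau>) * e"
    using E(2) c410 c311 by algebra
  note v = z z0 z1 c113 c212 c122 c221 c131 c311 c140 c410 c230 c320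
  show ?thesis
    unfolding normal_form_def hom_op_expand v
    apply (rule disjI2, rule disjI2, rule disjI1, intro conjI refl \<tau>)
    apply (rule exI[of _ e], intro allI)
    by (rule poly_ext) (simp add: Delta3_def op_of_coeffs_def dR_def eval_nat_numeral field_simps)
qed

section \<open>Values and derivatives at the intersections of the coordinate lines\<close>

text \<open>
  Values of \<open>P\<close> at the intersection points \<open>e\<^sub>i - e\<^sub>j\<close> of the coordinate lines. With the index 4
  belonging to \<open>w\<close>, the values at \<open>e\<^sub>1 - e\<^sub>4\<close>, \<open>e\<^sub>2 - e\<^sub>4\<close>, \<open>e\<^sub>3 - e\<^sub>4\<close> are \<open>c 5 0 0\<close>,
  \<open>c 0 5 0\<close>, \<open>c 0 0 5\<close>.
\<close>

definition v12 :: "(nat \<Rightarrow> nat \<Rightarrow> nat \<Rightarrow> real) \<Rightarrow> real" where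
  "v12 c = c 5 0 0 - c 4 1 0 + c 3 2 0 - c 2 3 0 + c 1 4 0 - c 0 5 0"
definition v13 :: "(nat \<Rightarrow> nat \<Rightarrow> nat \<Rightarrow> real) \<Rightarrow> real" where
  "v13 c = c 5 0 0 - c 4 0 1 + c 3 0 2 - c 2 0 3 + c 1 0 4 - c 0 0 5"
definition v23 :: "(nat \<Rightarrow> nat \<Rightarrow> nat \<Rightarrow> real) \<Rightarrow> real" where
  "v23 c = c 0 5 0 - c 0 4 1 + c 0 3 2 - c 0 2 3 + c 0 1 4 - c 0 0 5"

lemma v_swap:
  "v12 (swap12 c) = - v12 c" "v13 (swap12 c) = v23 c" "v23 (swap12 c) = v13 c"
  "v12 (swap23 c) = v13 c" "v13 (swap23 c) = v12 c" "v23 (swap23 c) = - v23 c"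
  by (simp_all add: v12_def v13_def v23_def swap12_def swap23_def)

lemma v_dual:
  "v12 (dual c) = - c 0 5 0" "v13 (dual c) = - c 0 0 5" "v23 (dual c) = v23 c"
  "dual c 5 0 0 = - c 5 0 0" "dual c 0 5 0 = - v12 c" "dual c 0 0 5 = - v13 c"
  by (simp_all add: v12_def v13_def v23_def dual_values dual_values[simplified])

text \<open>
  The first equation is the one for \<open>x^6 d/dx\<close>, in which only fifth powers survive. The others are
  the same equation for the three dual operators: \<open>\<Sum>\<^sub>i w\<^sub>i v\<^sub>i\<^sub>j = 0\<close> for the weights \<open>w\<^sub>i\<close> and
  each \<open>j\<close>.
\<close>

lemma row_sums:
  assumes "inv_coeffs lam \<gamma> \<tau> c" and \<rho>: "\<rho> = - 4 - lam - \<gamma> - \<tau>"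
  shows "lam * c 5 0 0 + \<gamma> * c 0 5 0 + \<tau> * c 0 0 5 = 0"
    and "\<gamma> * v12 c + \<tau> * v13 c + \<rho> * c 5 0 0 = 0"
    and "lam * v12 c = \<tau> * v23 c + \<rho> * c 0 5 0"
    and "lam * v13 c + \<gamma> * v23 c = \<rho> * c 0 0 5"
proof -
  have 1: "\<rho>' * c 5 0 0 + \<gamma>' * v12 c + \<tau>' * v13 c = 0"
    if "inv_coeffs lam' \<gamma>' \<tau>' c" "\<rho>' = - 4 - lam' - \<gamma>' - \<tau>'" for lam' \<gamma>' \<tau>' \<rho>' c
    using inv_coeffs_eqs(35)[OF inv_coeffs_dual[OF that]] by (simp add: v_dual)
  show "lam * c 5 0 0 + \<gamma> * c 0 5 0 + \<tau> * c 0 0 5 = 0"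
    using inv_coeffs_eqs(35)[OF assms(1)] by simp
  show "\<gamma> * v12 c + \<tau> * v13 c + \<rho> * c 5 0 0 = 0"
    using 1[OF assms] by simp
  show "lam * v12 c = \<tau> * v23 c + \<rho> * c 0 5 0"
    using 1[OF inv_coeffs_swap12[OF assms(1)], of \<rho>] \<rho> by (simp add: v_swap) (simp add: swap12_def)
  show "lam * v13 c + \<gamma> * v23 c = \<rho> * c 0 0 5"
    using 1[OF inv_coeffs_swap12[OF inv_coeffs_swap23[OF assms(1)]], of \<rho>] \<rho>
    by (simp add: v_swap) (simp add: swap12_def swap23_def)
qed

text \<open>
  The derivatives of \<open>P\<close> in the direction of the first variable at the three points of \<open>x = 0\<close>. The
  equation for \<open>x^5 d/dx\<close> relates two of them to a value of \<open>P\<close>; it holds for the operator itself and for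
  its dualizations in the second and third slot. Taken symmetrically, as in the third claim, the three
  derivatives times the products of the two weights are unknowns whose pairwise sums are given.
\<close>

lemma edge_derivs:
  assumes "inv_coeffs lam \<gamma> \<tau> c" and \<rho>: "\<rho> = - 4 - lam - \<gamma> - \<tau>"
  shows "\<gamma> * \<rho> * c 1 4 0 = (1 + 5/2 * lam) * \<tau> * v13 c + 5/2 * \<gamma> * \<rho> * c 0 5 0"
    and "\<tau> * \<rho> * c 1 0 4 = (1 + 5/2 * lam) * \<gamma> * v12 c + 5/2 * \<tau> * \<rho> * c 0 0 5"
    and "\<gamma> * \<tau> * (c 1 4 0 - c 1 3 1 + c 1 2 2 - c 1 1 3 + c 1 0 4
           - 1/2 * (5 * c 0 5 0 - 3 * c 0 4 1 + c 0 3 2 + c 0 2 3 - 3 * c 0 1 4 + 5 * c 0 0 5))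
       = (1 + 5/2 * lam) * \<rho> * c 5 0 0"
proof -
  note R = row_sums[OF assms]
  \<comment> \<open>The directional derivatives are taken in the plane \<open>x + y + z + w = 0\<close>; changing the chart
    alters them by a multiple of the value, by Euler's identity.\<close>
  have 4: "(1 + 5 * lam) * c 5 0 0 + \<gamma> * c 1 4 0 + \<tau> * c 1 0 4 = 0"
    using inv_coeffs_eqs(32)[OF assms(1)] by algebra
  have 2: "(1 + 5 * lam) * v12 c + \<rho> * (c 1 4 0 - 5 * c 0 5 0)
     + \<tau> * (c 1 4 0 - c 1 3 1 + c 1 2 2 - c 1 1 3 + c 1 0 4 - (5 * c 0 5 0 - 4 * c 0 4 1 + 3 * c 0 3 2 - 2 * c 0 2 3 + c 0 1 4)) = 0"
    using inv_coeffs_eqs(33)[OF inv_coeffs_dual[OF inv_coeffs_swap12[OF assms(1)], of \<rho>]] \<rho>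
    unfolding dual_values swap12_def v12_def by algebra
  have 3: "(1 + 5 * lam) * v13 c + \<rho> * (c 1 0 4 - 5 * c 0 0 5)
     + \<gamma> * (c 1 4 0 - c 1 3 1 + c 1 2 2 - c 1 1 3 + c 1 0 4 - (c 0 4 1 - 2 * c 0 3 2 + 3 * c 0 2 3 - 4 * c 0 1 4 + 5 * c 0 0 5)) = 0"
    using inv_coeffs_eqs(33)[OF inv_coeffs_dual[OF inv_coeffs_swap12[OF inv_coeffs_swap23[OF assms(1)]], of \<rho>]] \<rho>
    unfolding dual_values swap12_def swap23_def v13_def by algebra
  show "\<gamma> * \<rho> * c 1 4 0 = (1 + 5/2 * lam) * \<tau> * v13 c + 5/2 * \<gamma> * \<rho> * c 0 5 0"
    using 2 3 4 R unfolding v23_def by algebra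
  show "\<tau> * \<rho> * c 1 0 4 = (1 + 5/2 * lam) * \<gamma> * v12 c + 5/2 * \<tau> * \<rho> * c 0 0 5"
    using 2 3 4 R unfolding v23_def by algebra
  show "\<gamma> * \<tau> * (c 1 4 0 - c 1 3 1 + c 1 2 2 - c 1 1 3 + c 1 0 4
           - 1/2 * (5 * c 0 5 0 - 3 * c 0 4 1 + c 0 3 2 + c 0 2 3 - 3 * c 0 1 4 + 5 * c 0 0 5))
       = (1 + 5/2 * lam) * \<rho> * c 5 0 0"
    using 2 3 4 R unfolding v23_def by algebra
qed

section \<open>Four nonzero weights\<close>

text \<open>
  The weights are \<open>A + B + C - 1\<close>, \<open>A - B - C - 1\<close>, \<open>B - A - C - 1\<close> and \<open>C - A - B - 1\<close>. The numbers
  \<open>w\<^sub>i w\<^sub>j v\<^sub>i\<^sub>j\<close> form an antisymmetric matrix with zero row sums; such matrices are parametrized by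
  \<open>(X, Y, Z)\<close>. In these coordinates permutations of the four slots act by signed permutations on
  \<open>(A, B, C)\<close> and \<open>(X, Y, Z)\<close>.
\<close>

definition vertex_data :: "real \<Rightarrow> real \<Rightarrow> real \<Rightarrow> real \<Rightarrow> real \<Rightarrow> real \<Rightarrow> (nat \<Rightarrow> nat \<Rightarrow> nat \<Rightarrow> real) \<Rightarrow> bool" where
  "vertex_data A B C X Y Z c \<longleftrightarrow>
     inv_coeffs (A + B + C - 1) (A - B - C - 1) (B - A - C - 1) c \<and>
     (A + B + C - 1) * (A - B - C - 1) * v12 c = 2 * (Y - Z) \<and>
     (A + B + C - 1) * (B - A - C - 1) * v13 c = 2 * (Z - X) \<and>
     (A - B - C - 1) * (B - A - C - 1) * v23 c = 2 * (X + Y) \<and>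
     (A + B + C - 1) * (C - A - B - 1) * c 5 0 0 = 2 * (X - Y) \<and>
     (A - B - C - 1) * (C - A - B - 1) * c 0 5 0 = - 2 * (X + Z) \<and>
     (B - A - C - 1) * (C - A - B - 1) * c 0 0 5 = 2 * (Y + Z)"

lemma vertex_data_exists:
  assumes inv: "inv_coeffs lam \<gamma> \<tau> c"
  obtains A B C X Y Z where "vertex_data A B C X Y Z c"
    "lam = A + B + C - 1" "\<gamma> = A - B - C - 1" "\<tau> = B - A - C - 1"
proof -
  define \<rho> where "\<rho> = - 4 - lam - \<gamma> - \<tau>"
  define A where "A = (lam + \<gamma>) / 2 + 1"
  define B where "B = (lam + \<tau>) / 2 + 1"
  define C where "C = - (\<gamma> + \<tau>) / 2 - 1"
  have w: "lam = A + B + C - 1" "\<gamma> = A - B - C - 1" "\<tau> = B - A - C - 1" "\<rho> = C - A - B - 1"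
    unfolding A_def B_def C_def \<rho>_def by (simp_all add: field_simps)
  note R = row_sums[OF inv \<rho>_def]
  define X where "X = (lam * \<rho> * c 5 0 0 + \<gamma> * \<tau> * v23 c) / 4"
  define Y where "Y = (lam * \<gamma> * v12 c + \<tau> * \<rho> * c 0 0 5) / 4"
  define Z where "Z = (lam * \<tau> * v13 c - \<gamma> * \<rho> * c 0 5 0) / 4"
  have X: "4 * X = lam * \<rho> * c 5 0 0 + \<gamma> * \<tau> * v23 c" by (simp add: X_def)
  have Y: "4 * Y = lam * \<gamma> * v12 c + \<tau> * \<rho> * c 0 0 5" by (simp add: Y_def)
  have Z: "4 * Z = lam * \<tau> * v13 c - \<gamma> * \<rho> * c 0 5 0" by (simp add: Z_def)
  have "lam * \<gamma> * v12 c = 2 * (Y - Z)" "lam * \<tau> * v13 c = 2 * (Z - X)" "\<gamma> * \<tau> * v23 c = 2 * (X + Y)"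
    "lam * \<rho> * c 5 0 0 = 2 * (X - Y)" "\<gamma> * \<rho> * c 0 5 0 = - 2 * (X + Z)" "\<tau> * \<rho> * c 0 0 5 = 2 * (Y + Z)"
    using R X Y Z by algebra+
  then have "vertex_data A B C X Y Z c"
    using inv unfolding vertex_data_def w by blast
  then show thesis using that w by blast
qed

lemma vertex_data_swap12:
  assumes "vertex_data A B C X Y Z c"
  shows "vertex_data A (- C) (- B) (- X) Z Y (swap12 c)"
proof -
  have e: "A + - C + - B - 1 = A - B - C - 1" "A - - C - - B - 1 = A + B + C - 1" "- C - A - - B - 1 = B - A - C - 1"
     "- B - A - - C - 1 = C - A - B - 1" by simp_all
  have s: "swap12 c 5 0 0 = c 0 5 0" "swap12 c 0 5 0 = c 5 0 0" "swap12 c 0 0 5 = c 0 0 5"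
    by (simp_all add: swap12_def)
  show ?thesis
    using assms inv_coeffs_swap12 unfolding vertex_data_def v_swap e s by (auto simp: mult_ac)
qed

lemma vertex_data_swap23:
  assumes "vertex_data A B C X Y Z c"
  shows "vertex_data B A C (- Y) (- X) (- Z) (swap23 c)"
proof -
  have e: "B + A + C - 1 = A + B + C - 1" "C - B - A - 1 = C - A - B - 1" by simp_all
  have s: "swap23 c 5 0 0 = c 5 0 0" "swap23 c 0 5 0 = c 0 0 5" "swap23 c 0 0 5 = c 0 5 0"
    by (simp_all add: swap23_def)
  show ?thesis
    using assms inv_coeffs_swap23 unfolding vertex_data_def v_swap e s by (auto simp: mult_ac)
qed

text \<open>
  On \<open>z = 0\<close> the form \<open>P\<close> is a binary quintic, hence determined by its values and derivatives at the
  three points where the other coordinate lines meet this line. Two of the derivatives are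
  coefficients; the third, at \<open>e\<^sub>1 - e\<^sub>2\<close>, is a derivative of the dual form at \<open>x = z = 0\<close>.
\<close>

lemma line_coeffs:
  assumes "vertex_data A B C X Y Z c"
  defines "lam \<equiv> A + B + C - 1" and "\<gamma> \<equiv> A - B - C - 1" and "\<tau> \<equiv> B - A - C - 1" and "\<rho> \<equiv> C - A - B - 1"
  shows "lam * \<gamma> * \<rho> * c 1 4 0 = (2 + 5 * lam) * (Z - X) - 5 * lam * (X + Z)"
    and "lam * \<gamma> * \<rho> * c 4 1 0 = (2 + 5 * \<gamma>) * (X + Y) + 5 * \<gamma> * (X - Y)"
    and "lam * \<gamma> * \<rho> * c 2 3 0 = (2 + 5 * \<rho>) * (Y + Z) - \<rho> * (Y - Z) - 4 * \<gamma> * (X - Y) + 6 * lam * (X + Z)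
           + lam * \<gamma> * \<rho> * c 4 1 0 + 2 * (lam * \<gamma> * \<rho> * c 1 4 0)"
    and "lam * \<gamma> * \<rho> * c 3 2 0 = (2 + 5 * \<rho>) * (Y + Z) + \<rho> * (Y - Z) - 6 * \<gamma> * (X - Y) + 4 * lam * (X + Z)
           + 2 * (lam * \<gamma> * \<rho> * c 4 1 0) + lam * \<gamma> * \<rho> * c 1 4 0"
proof -
  have inv: "inv_coeffs lam \<gamma> \<tau> c" and \<rho>: "\<rho> = - 4 - lam - \<gamma> - \<tau>"
    and u: "lam * \<gamma> * v12 c = 2 * (Y - Z)" "lam * \<tau> * v13 c = 2 * (Z - X)" "\<gamma> * \<tau> * v23 c = 2 * (X + Y)"
    "lam * \<rho> * c 5 0 0 = 2 * (X - Y)" "\<gamma> * \<rho> * c 0 5 0 = - 2 * (X + Z)" "\<tau> * \<rho> * c 0 0 5 = 2 * (Y + Z)"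
    using assms(1) unfolding vertex_data_def lam_def \<gamma>_def \<tau>_def \<rho>_def by simp_all
  show "lam * \<gamma> * \<rho> * c 1 4 0 = (2 + 5 * lam) * (Z - X) - 5 * lam * (X + Z)"
    using edge_derivs(1)[OF inv \<rho>] u by algebra
  have "lam * \<rho> * c 4 1 0 = (1 + 5/2 * \<gamma>) * \<tau> * v23 c + 5/2 * lam * \<rho> * c 5 0 0"
    using edge_derivs(1)[OF inv_coeffs_swap12[OF inv], of \<rho>] \<rho> by (simp add: v_swap) (simp add: swap12_def)
  then show "lam * \<gamma> * \<rho> * c 4 1 0 = (2 + 5 * \<gamma>) * (X + Y) + 5 * \<gamma> * (X - Y)"
    using u by algebra
  have "\<gamma> * lam * dual c 1 4 0 = - ((1 + 5/2 * \<rho>) * \<tau> * c 0 0 5) - 5/2 * \<gamma> * lam * v12 c"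
    using edge_derivs(1)[OF inv_coeffs_dual[OF inv \<rho>], of lam] \<rho> by (simp add: v_dual)
  \<comment> \<open>The derivative of \<open>P(x, y, 0)\<close> with respect to \<open>x\<close> at \<open>(1, - 1)\<close>.\<close>
  then have D: "\<gamma> * lam * (5 * c 5 0 0 - 4 * c 4 1 0 + 3 * c 3 2 0 - 2 * c 2 3 0 + c 1 4 0)
      = (1 + 5/2 * \<rho>) * \<tau> * c 0 0 5 + 5/2 * \<gamma> * lam * v12 c"
    unfolding dual_values by algebra
  show "lam * \<gamma> * \<rho> * c 2 3 0 = (2 + 5 * \<rho>) * (Y + Z) - \<rho> * (Y - Z) - 4 * \<gamma> * (X - Y) + 6 * lam * (X + Z)
           + lam * \<gamma> * \<rho> * c 4 1 0 + 2 * (lam * \<gamma> * \<rho> * c 1 4 0)"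
    using D u(1,4,5,6) unfolding v12_def by algebra
  show "lam * \<gamma> * \<rho> * c 3 2 0 = (2 + 5 * \<rho>) * (Y + Z) + \<rho> * (Y - Z) - 6 * \<gamma> * (X - Y) + 4 * lam * (X + Z)
           + 2 * (lam * \<gamma> * \<rho> * c 4 1 0) + lam * \<gamma> * \<rho> * c 1 4 0"
    using D u(1,4,5,6) unfolding v12_def by algebra
qed

text \<open>
  The equation for \<open>x^4 d/dx\<close> at the monomial \<open>x^2\<close> involves only coefficients of \<open>P\<close> on the lines
  \<open>z = 0\<close> and \<open>y = 0\<close>, which are known.
\<close>

lemma vertex_product_eq:
  assumes vd: "vertex_data A B C X Y Z c"
  shows "A * X = B * Y"
proof -
  note E = inv_coeffs_eqs[of "A + B + C - 1" "A - B - C - 1" "B - A - C - 1" c]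
  have inv: "inv_coeffs (A + B + C - 1) (A - B - C - 1) (B - A - C - 1) c"
    and 5: "(A + B + C - 1) * (C - A - B - 1) * c 5 0 0 = 2 * (X - Y)"
    using vd unfolding vertex_data_def by simp_all
  note z = line_coeffs[OF vd]
  note y = line_coeffs[OF vertex_data_swap23[OF vd], unfolded swap23_def]
  show ?thesis
    using E(26)[OF inv] 5 z(1-3) y(1-3) by algebra
qed

text \<open>
  The equations for \<open>x^3 d/dx\<close> at \<open>x y^2\<close> and \<open>x z^2\<close> both contain \<open>c 1 2 2\<close>, with coefficients \<open>\<tau>\<close> and
  \<open>\<gamma>\<close>. Eliminating it leaves a relation between coefficients on the lines \<open>z = 0\<close> and \<open>y = 0\<close>.
\<close>

lemma edge_relation:
  assumes vd: "vertex_data A B C X Y Z c"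
  shows "12 * (A * X) * (A + B + C) + 3 * (A * (Y + Z) + B * (X + Z) + C * (X + Y)) = X + Y + Z"
proof -
  note E = inv_coeffs_eqs[of "A + B + C - 1" "A - B - C - 1" "B - A - C - 1" c]
  have inv: "inv_coeffs (A + B + C - 1) (A - B - C - 1) (B - A - C - 1) c"
    and 5: "(A + B + C - 1) * (C - A - B - 1) * c 5 0 0 = 2 * (X - Y)"
    using vd unfolding vertex_data_def by simp_all
  note z = line_coeffs[OF vd]
  note y = line_coeffs[OF vertex_data_swap23[OF vd], unfolded swap23_def]
  note p = vertex_product_eq[OF vd] vertex_product_eq[OF vertex_data_swap23[OF vertex_data_swap12[OF vd]]]
  have "(A - B - C - 1) * (2 * (2 + 3 * (A - B - C - 1)) * c 1 4 0 + (1 + 3 * (A + B + C - 1)) * c 3 2 0)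
     = (B - A - C - 1) * (2 * (2 + 3 * (B - A - C - 1)) * c 1 0 4 + (1 + 3 * (A + B + C - 1)) * c 3 0 2)"
    using E(19)[OF inv] E(21)[OF inv] by algebra
  then show ?thesis
    using z(1,2,4) y(1,2,4) p by algebra
qed

text \<open>
  If the common value \<open>A X = B Y = C Z\<close> is nonzero, substituting \<open>X = m / A\<close> etc. removes \<open>X\<close>, \<open>Y\<close>,
  \<open>Z\<close>. In terms of \<open>p = A B / C\<close>, \<open>q = A C / B\<close>, \<open>r = B C / A\<close> the equations become
  \<open>12 p q + 3 (p + q) = 1\<close> and its two companions, whose differences factor and force \<open>p = q = r\<close>. If the
  common value is zero, a nonzero solution needs two of \<open>A\<close>, \<open>B\<close>, \<open>C\<close> to vanish.
\<close>

lemma edge_equations_solutions: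
  fixes A B C X Y Z :: real
  assumes m: "A * X = B * Y" "B * Y = C * Z"
    and eX: "X = 12 * (A * X) * A + 3 * (B * Z + C * Y)"
    and eY: "Y = 12 * (A * X) * B + 3 * (A * Z + C * X)"
    and eZ: "Z = 12 * (A * X) * C + 3 * (A * Y + B * X)"
  shows "X = 0 \<and> Y = 0 \<and> Z = 0
    \<or> 9 * A\<^sup>2 = 1 \<and> B = 0 \<and> C = 0 \<or> 9 * B\<^sup>2 = 1 \<and> A = 0 \<and> C = 0 \<or> 9 * C\<^sup>2 = 1 \<and> A = 0 \<and> B = 0
    \<or> (\<exists>p. 12 * p\<^sup>2 + 6 * p = 1 \<and> (A, B, C) \<in> {(p, p, p), (p, -p, -p), (-p, p, -p), (-p, -p, p)})"
proof (cases "A * X = 0")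
  case True
  have 0: "A * X = 0" "B * Y = 0" "C * Z = 0" using True m by auto
  have e: "X = 3 * (B * Z + C * Y)" "Y = 3 * (A * Z + C * X)" "Z = 3 * (A * Y + B * X)"
    using eX eY eZ True by algebra+
  have "A = 0 \<or> X = 0" "B = 0 \<or> Y = 0" "C = 0 \<or> Z = 0" using 0 by auto
  then consider "X = 0" "Y = 0" | "X = 0" "Z = 0" | "Y = 0" "Z = 0"
    | "A = 0" "B = 0" | "A = 0" "C = 0" | "B = 0" "C = 0" by argo
  then show ?thesis
  proof cases
    case 1 then show ?thesis using e(3) by simp
  next
    case 2 then show ?thesis using e(2) by simp
  next
    case 3 then show ?thesis using e(1) by simp
  next
    case 4
    then have "X = 3 * C * Y" "Y = 3 * C * X" "Z = 0" using e by algebra+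
    moreover from this have "X * (9 * C\<^sup>2 - 1) = 0" by algebra
    ultimately show ?thesis using 4 by (cases "X = 0") auto
  next
    case 5
    then have "X = 3 * B * Z" "Z = 3 * B * X" "Y = 0" using e by algebra+
    moreover from this have "X * (9 * B\<^sup>2 - 1) = 0" by algebra
    ultimately show ?thesis using 5 by (cases "X = 0") auto
  next
    case 6
    then have "Y = 3 * A * Z" "Z = 3 * A * Y" "X = 0" using e by algebra+
    moreover from this have "Y * (9 * A\<^sup>2 - 1) = 0" by algebra
    ultimately show ?thesis using 6 by (cases "Y = 0") auto
  qed
next
  case False
  then have nz: "A \<noteq> 0" "B \<noteq> 0" "C \<noteq> 0" using m by auto
  define p q r where "p = A * B / C" and "q = A * C / B" and "r = B * C / A"
  have pqr: "p * C = A * B" "q * B = A * C" "r * A = B * C" 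
    using nz by (simp_all add: p_def q_def r_def)
  have sq: "A\<^sup>2 = p * q" "B\<^sup>2 = p * r" "C\<^sup>2 = q * r"
    using nz by (simp_all add: p_def q_def r_def power2_eq_square)
  have "A * X * (B * C) * (12 * (p * q) + 3 * (p + q) - 1) = 0"
    using eX m pqr sq by algebra
  then have 1: "12 * (p * q) + 3 * (p + q) = 1" using False nz by simp
  have "A * X * (A * C) * (12 * (p * r) + 3 * (p + r) - 1) = 0"
    using eY m pqr sq by algebra
  then have 2: "12 * (p * r) + 3 * (p + r) = 1" using False nz by simp
  have "A * X * (A * B) * (12 * (q * r) + 3 * (q + r) - 1) = 0"
    using eZ m pqr sq by algebra
  then have 3: "12 * (q * r) + 3 * (q + r) = 1" using False nz by simp
  \<comment> \<open>Needed to cancel the factor \<open>12 p + 3\<close> in the differences.\<close>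
  have ne: "12 * x + 3 \<noteq> 0" if "12 * (x * y) + 3 * (x + y) = 1" for x y :: real
  proof
    assume "12 * x + 3 = 0"
    then have "x = -1/4" by simp
    with that show False by simp
  qed
  have "(q - r) * (12 * p + 3) = 0" "(p - r) * (12 * q + 3) = 0" using 1 2 3 by algebra+
  then have eq: "q = p" "r = p" using ne[OF 1] ne[OF 3] by auto
  have p: "12 * p\<^sup>2 + 6 * p = 1" using 1 unfolding eq by (simp add: power2_eq_square)
  have "A\<^sup>2 = p\<^sup>2" "B\<^sup>2 = p\<^sup>2" using sq unfolding eq by (simp_all add: power2_eq_square)
  then have AB: "A = p \<or> A = - p" "B = p \<or> B = - p" by (simp_all add: power2_eq_iff)
  have "p \<noteq> 0" using p by auto
  with pqr(1) have "C = A * B / p" by (simp add: field_simps)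
  with AB \<open>p \<noteq> 0\<close> have "(A, B, C) \<in> {(p, p, p), (p, -p, -p), (-p, p, -p), (-p, -p, p)}"
    by auto
  with p show ?thesis by blast
qed

lemma line_coeffs_zero:
  assumes "vertex_data A B C 0 0 0 c"
    and "A + B + C - 1 \<noteq> 0" "A - B - C - 1 \<noteq> 0" "C - A - B - 1 \<noteq> 0"
  shows "c 1 4 0 = 0" "c 4 1 0 = 0" "c 2 3 0 = 0" "c 3 2 0 = 0"
  using line_coeffs[OF assms(1)] assms(2-) by simp_all

text \<open>
  The three equations solved in \<open>edge_equations_solutions\<close> are combinations of \<open>edge_relation\<close> and its
  images under two permutations. If \<open>X = Y = Z = 0\<close> and no weight vanishes, then \<open>P\<close>
  vanishes on the lines \<open>x = 0\<close>, \<open>y = 0\<close>, \<open>z = 0\<close>, and the remaining coefficients are killed by the weights multiplying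
  them.
\<close>

lemma nonzero_weights_solutions:
  assumes vd: "vertex_data A B C X Y Z c" and nz: "nonzero_coeffs c"
    and w: "A + B + C - 1 \<noteq> 0" "A - B - C - 1 \<noteq> 0" "B - A - C - 1 \<noteq> 0" "C - A - B - 1 \<noteq> 0"
  shows "9 * A\<^sup>2 = 1 \<and> B = 0 \<and> C = 0 \<or> 9 * B\<^sup>2 = 1 \<and> A = 0 \<and> C = 0 \<or> 9 * C\<^sup>2 = 1 \<and> A = 0 \<and> B = 0
    \<or> (\<exists>p. 12 * p\<^sup>2 + 6 * p = 1 \<and> (A, B, C) \<in> {(p, p, p), (p, -p, -p), (-p, p, -p), (-p, -p, p)})"
proof -
  note vd12 = vertex_data_swap12[OF vd] and vd23 = vertex_data_swap23[OF vd]
  note vd312 = vertex_data_swap12[OF vd23]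
  have m: "A * X = B * Y" "B * Y = C * Z"
    using vertex_product_eq[OF vd] vertex_product_eq[OF vd12] by simp_all
  note R = edge_relation[OF vd] edge_relation[OF vd12] edge_relation[OF vd312]
  have "\<not> (X = 0 \<and> Y = 0 \<and> Z = 0)"
  proof
    assume 0: "X = 0 \<and> Y = 0 \<and> Z = 0"
    have inv: "inv_coeffs (A + B + C - 1) (A - B - C - 1) (B - A - C - 1) c"
      using vd unfolding vertex_data_def by blast
    note E = inv_coeffs_eqs[OF inv]
    have v: "c 5 0 0 = 0" "c 0 5 0 = 0" "c 0 0 5 = 0"
      using vd 0 w unfolding vertex_data_def by auto
    have w': "B + A + C - 1 \<noteq> 0" "B - A - C - 1 \<noteq> 0" "C - B - A - 1 \<noteq> 0"
      "- C + A + - B - 1 \<noteq> 0" "- C - A - - B - 1 \<noteq> 0" "- B - - C - A - 1 \<noteq> 0"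
      using w by (simp_all add: algebra_simps)
    have vd0: "vertex_data A B C 0 0 0 c" using vd 0 by simp
    note z = line_coeffs_zero[OF vd0 w(1,2,4)]
    have "vertex_data B A C 0 0 0 (swap23 c)"
      using vertex_data_swap23[OF vd0] by simp
    note y = line_coeffs_zero[OF this w'(1-3), unfolded swap23_def]
    have "vertex_data (- C) A (- B) 0 0 0 (swap23 (swap12 c))"
      using vertex_data_swap23[OF vertex_data_swap12[OF vd0]] by simp
    note x = line_coeffs_zero[OF this w'(4-6), unfolded swap23_def swap12_def]
    have 1: "c 1 1 3 = 0" "c 1 3 1 = 0" "c 3 1 1 = 0"
      using E(27,28,30) v z y x w by auto
    have 2: "c 1 2 2 = 0" "c 2 1 2 = 0" "c 2 2 1 = 0"
      using E(17,18,19) v z y x w by auto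
    have "c i j l = 0" if "i + j + l = 5" for i j l
      using that by (rule order_5_cases) (use v z y x 1 2 in simp_all)
    with nz show False unfolding nonzero_coeffs_def by blast
  qed
  moreover have "X = 12 * (A * X) * A + 3 * (B * Z + C * Y)"
    "Y = 12 * (A * X) * B + 3 * (A * Z + C * X)" "Z = 12 * (A * X) * C + 3 * (A * Y + B * X)"
    using R m by algebra+
  ultimately show ?thesis using edge_equations_solutions[OF m] by blast
qed

section \<open>Exactly one zero weight\<close>

text \<open>
  For \<open>lam = 0\<close> the terms with undifferentiated first argument form an invariant binary operator of
  order 5. A nonzero coefficient \<open>c 0 5 0\<close> would require both \<open>g + t = - 11/5\<close> and \<open>g + t = - 3/2\<close>.
\<close>

lemma restriction_zero:
  assumes inv: "inv_coeffs 0 g t c" and nz: "g \<noteq> 0" "t \<noteq> 0"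
  shows "c 0 5 0 = 0" "c 0 0 5 = 0" "c 0 4 1 = 0" "c 0 1 4 = 0" "c 0 3 2 = 0" "c 0 2 3 = 0"
proof -
  note E = inv_coeffs_eqs[OF inv]
  have "g * c 0 5 0 * (11 + 5 * g + 5 * t) = 0"
    using E(11) E(34) E(35) by algebra
  moreover have "g * c 0 5 0 * (2 * g + 2 * t + 3) = 0"
    using E(22) E(31) E(35) by algebra
  ultimately show 0: "c 0 5 0 = 0"
    using nz by auto
  show 1: "c 0 0 5 = 0" using E(35) 0 nz by simp
  show "c 0 4 1 = 0" "c 0 1 4 = 0" "c 0 3 2 = 0" "c 0 2 3 = 0"
    using E(29,31,33,34) 0 1 nz by simp_all
qed

text \<open>
  For \<open>lam = 0\<close> and \<open>i \<ge> 1\<close> the equations for \<open>x^2 d/dx\<close> express \<open>c (i + 1) j l\<close> through coefficients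
  with first index \<open>i\<close>. So everything is determined by the five numbers \<open>c 1 j l\<close>, on which the other
  equations impose six linear conditions. By one of these conditions and \<open>edge_derivs\<close> the five unknowns
  reduce to three, \<open>C3\<close>, \<open>s2\<close> and \<open>s3\<close>, which satisfy the five equations \<open>r0\<close> to \<open>r4\<close>. They cannot all vanish, so the \<open>3 \<times> 3\<close> minors do; three of the
  minors have the stated polynomials as factors.
\<close>

lemma one_zero_weight:
  assumes inv: "inv_coeffs 0 g t c" and nzc: "nonzero_coeffs c" and r: "r = - 4 - g - t"
    and nz: "g \<noteq> 0" "t \<noteq> 0" "r \<noteq> 0"
  defines "e1 \<equiv> g + t" and "e2 \<equiv> g * t"
  shows "18 * e1^2 * e2 + 42 * e1^3 + 87 * e1 * e2 + 301 * e1^2 + 85 * e2 + 672 * e1 + 460 = 0"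
    and "g \<noteq> t \<Longrightarrow> 3 * e1^2 * e2 + 7 * e1^3 + 15 * e1 * e2 + 53 * e1^2 + 15 * e2 + 125 * e1 + 90 = 0"
    and "g \<noteq> t \<Longrightarrow> 9 * e1 * e2 + 11 * e1^2 + 25 * e2 + 64 * e1 + 100 = 0"
proof -
  note E = inv_coeffs_eqs[OF inv]
  note z = restriction_zero[OF inv nz(1,2)]
  have r': "r = - 4 - 0 - g - t" using r by simp
  note V = edge_derivs[OF inv r', unfolded z]
  define s2 where "s2 = t * r * c 1 0 4"
  define s3 where "s3 = g * r * c 1 4 0"
  define C1 where "C1 = g * t * r * c 1 1 3"
  define C2 where "C2 = g * t * r * c 1 2 2"
  define C3 where "C3 = g * t * r * c 1 3 1"
  note d = s2_def s3_def C1_def C2_def C3_def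
  \<comment> \<open>The derivatives across \<open>x = 0\<close> at its three special points, times two weights each, sum to zero.\<close>
  have C2: "C2 = - (s2 + s3) * r - t * s3 - g * s2 + C3 + C1"
    using V row_sums(2)[OF inv r'] unfolding d by algebra
  \<comment> \<open>The equations for \<open>x^2 d/dx\<close> recover the coefficients with \<open>i = 2\<close> and then \<open>i = 3\<close>.\<close>
  have D2: "2 * c 2 3 0 = - (4 * (3 + 2 * g) * c 1 4 0 + 2 * t * c 1 3 1)"
    "2 * c 2 2 1 = - (6 * (1 + g) * c 1 3 1 + 2 * (1 + 2 * t) * c 1 2 2)"
    "2 * c 2 1 2 = - (2 * (1 + 2 * g) * c 1 2 2 + 6 * (1 + t) * c 1 1 3)"
    "2 * c 2 0 3 = - (2 * g * c 1 1 3 + 4 * (3 + 2 * t) * c 1 0 4)"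
    using E(7-10) by algebra+
  have m: "C1 + C3 = - (4 * g * s3 + 4 * t * s2 + 11 * (s2 + s3))"
  proof -
    have "g * (11 + 4 * g) * c 1 4 0 + g * t * (c 1 3 1 + c 1 1 3) + t * (11 + 4 * t) * c 1 0 4 = 0"
      using E(26) E(32) D2 by algebra
    then show ?thesis unfolding d by algebra
  qed
  have D3: "12 * c 3 2 0 = 6 * (1 + g) * (4 * (3 + 2 * g) * c 1 4 0 + 2 * t * c 1 3 1)
       + 2 * t * (6 * (1 + g) * c 1 3 1 + 2 * (1 + 2 * t) * c 1 2 2)"
    "12 * c 3 1 1 = 2 * (1 + 2 * g) * (6 * (1 + g) * c 1 3 1 + 2 * (1 + 2 * t) * c 1 2 2)
       + 2 * (1 + 2 * t) * (2 * (1 + 2 * g) * c 1 2 2 + 6 * (1 + t) * c 1 1 3)"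
    "12 * c 3 0 2 = 2 * g * (2 * (1 + 2 * g) * c 1 2 2 + 6 * (1 + t) * c 1 1 3)
       + 6 * (1 + t) * (2 * g * c 1 1 3 + 4 * (3 + 2 * t) * c 1 0 4)"
    using E(4-6) D2 by algebra+
  have C1: "C1 = - (4 * g * s3 + 4 * t * s2 + 11 * (s2 + s3)) - C3" using m by simp
  note R = C2[unfolded C1 r] C1
  \<comment> \<open>In \<open>q0\<close> to \<open>q4\<close> the coefficients with \<open>i \<ge> 2\<close> are eliminated from an invariance equation, and the
    result is multiplied by weights until only \<open>s2\<close>, \<open>s3\<close>, \<open>C1\<close>, \<open>C2\<close>, \<open>C3\<close> are left.\<close>
  have "12 * c 3 2 0 + 24 * (2 + 3 * g) * c 1 4 0 + 12 * t * c 1 2 2 = 0"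
    using E(19) by algebra
  then have q0: "6 * (1 + g) * (4 * (3 + 2 * g) * s3 + 2 * C3) + 2 * (6 * (1 + g) * C3 + 2 * (1 + 2 * t) * C2)
     + 24 * (2 + 3 * g) * s3 + 12 * C2 = 0"
    unfolding D3 d by algebra
  have "12 * c 3 0 2 + 12 * g * c 1 2 2 + 24 * (2 + 3 * t) * c 1 0 4 = 0"
    using E(21) by algebra
  then have q2: "2 * (2 * (1 + 2 * g) * C2 + 6 * (1 + t) * C1) + 6 * (1 + t) * (2 * C1 + 4 * (3 + 2 * t) * s2)
     + 12 * C2 + 24 * (2 + 3 * t) * s2 = 0"
    unfolding D3 d by algebra
  have "g * ((3 * t + 3) * C3 + (3 * g * t + 7 * g + 6 * t^2 + 27 * t + 32) * s2 + (3 * g^2 + 12 * g * t + 25 * g + 33 * t + 47) * s3) = 0"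
    using q2 unfolding R by algebra
  then have r0: "(3 * t + 3) * C3 + (3 * g * t + 7 * g + 6 * t^2 + 27 * t + 32) * s2 + (3 * g^2 + 12 * g * t + 25 * g + 33 * t + 47) * s3 = 0"
    using nz by simp
  have "t * ((3 * g + 3) * C3 - (3 * t^2 + 13 * t + 14) * s2 + (6 * g^2 - 3 * g * t + 18 * g - 7 * t + 1) * s3) = 0"
    using q0 unfolding R by algebra
  then have r2: "(3 * g + 3) * C3 - (3 * t^2 + 13 * t + 14) * s2 + (6 * g^2 - 3 * g * t + 18 * g - 7 * t + 1) * s3 = 0"
    using nz by simp
  have "12 * c 3 1 1 + 12 * (1 + 3 * g) * c 1 3 1 + 12 * (1 + 3 * t) * c 1 1 3 = 0"
    using E(20) by algebra
  then have q1: "2 * (1 + 2 * g) * (6 * (1 + g) * C3 + 2 * (1 + 2 * t) * C2)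
       + 2 * (1 + 2 * t) * (2 * (1 + 2 * g) * C2 + 6 * (1 + t) * C1) + 12 * (1 + 3 * g) * C3 + 12 * (1 + 3 * t) * C1 = 0"
    unfolding D3 d by algebra
  have r1: "(3 * g^2 + 9 * g - 3 * t^2 - 9 * t) * C3 - (12 * g * t^2 + 34 * g * t + 14 * g + 12 * t^3 + 75 * t^2 + 128 * t + 40) * s2
     - (12 * g^2 * t + 6 * g^2 + 12 * g * t^2 + 70 * g * t + 29 * g + 33 * t^2 + 113 * t + 40) * s3 = 0"
    using q1 unfolding R by algebra
  have "8 * (g * c 1 3 1 + (1 + 4 * t) * c 1 0 4) = 2 * g * c 2 2 1 + (1 + 3 * t) * (2 * c 2 0 3)"
    using E(18) E(28) by algebra
  then have q3: "8 * (C3 + (1 + 4 * t) * s2) + (6 * (1 + g) * C3 + 2 * (1 + 2 * t) * C2)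
     + (1 + 3 * t) * (2 * C1 + 4 * (3 + 2 * t) * s2) = 0"
    using D2 unfolding d by algebra
  have "g * ((3 * g - 3 * t + 6) * C3 - (6 * t^2 + 16 * t + 8) * s2 - (18 * g * t + 7 * g + 47 * t + 18) * s3) = 0"
    using q3 unfolding R by algebra
  then have r3: "(3 * g - 3 * t + 6) * C3 - (6 * t^2 + 16 * t + 8) * s2 - (18 * g * t + 7 * g + 47 * t + 18) * s3 = 0"
    using nz by simp
  have "8 * ((1 + 4 * g) * c 1 4 0 + t * c 1 1 3) = (1 + 3 * g) * (2 * c 2 3 0) + 2 * t * c 2 1 2"
    using E(17) E(27) by algebra
  then have q4: "8 * ((1 + 4 * g) * s3 + C1) + (1 + 3 * g) * (4 * (3 + 2 * g) * s3 + 2 * C3)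
     + (2 * (1 + 2 * g) * C2 + 6 * (1 + t) * C1) = 0"
    using D2 unfolding d by algebra
  have "t * ((3 * g - 3 * t - 6) * C3 - (6 * g * t + 14 * g + 12 * t^2 + 64 * t + 84) * s2 + (6 * g^2 - 12 * g * t - 7 * g - 33 * t - 74) * s3) = 0"
    using q4 unfolding R by algebra
  then have r4: "(3 * g - 3 * t - 6) * C3 - (6 * g * t + 14 * g + 12 * t^2 + 64 * t + 84) * s2 + (6 * g^2 - 12 * g * t - 7 * g - 33 * t - 74) * s3 = 0"
    using nz by simp
  have ne: "\<not> (C3 = 0 \<and> s2 = 0 \<and> s3 = 0)"
  proof
    assume 0: "C3 = 0 \<and> s2 = 0 \<and> s3 = 0"
    then have "C1 = 0" using C1 by simp
    moreover from this have "C2 = 0" using C2 0 by simp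
    ultimately have 1: "c 1 4 0 = 0" "c 1 3 1 = 0" "c 1 2 2 = 0" "c 1 1 3 = 0" "c 1 0 4 = 0"
      using 0 nz unfolding d by simp_all
    then have 2: "c 2 3 0 = 0" "c 2 2 1 = 0" "c 2 1 2 = 0" "c 2 0 3 = 0" "c 3 2 0 = 0" "c 3 1 1 = 0" "c 3 0 2 = 0"
      using D2 D3 by simp_all
    then have 3: "c 4 1 0 = 0" "c 4 0 1 = 0" "c 5 0 0 = 0"
      using E(27,28,32) 1 by simp_all
    have "c i j l = 0" if "i + j + l = 5" for i j l
      using that by (rule order_5_cases) (use z 1 2 3 in simp_all)
    with nzc show False unfolding nonzero_coeffs_def by blast
  qed
  have det: "a1 * (b2 * c3 - b3 * c2) - a2 * (b1 * c3 - b3 * c1) + a3 * (b1 * c2 - b2 * c1) = 0"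
    if "a1 * C3 + a2 * s2 + a3 * s3 = 0" "b1 * C3 + b2 * s2 + b3 * s3 = 0" "c1 * C3 + c2 * s2 + c3 * s3 = 0"
    for a1 a2 a3 b1 b2 b3 c1 c2 c3
  proof -
    let ?d = "a1 * (b2 * c3 - b3 * c2) - a2 * (b1 * c3 - b3 * c1) + a3 * (b1 * c2 - b2 * c1)"
    have "?d * C3 = 0" "?d * s2 = 0" "?d * s3 = 0" using that by algebra+
    with ne show ?thesis by auto
  qed
  have "r * (18 * e1^2 * e2 + 42 * e1^3 + 87 * e1 * e2 + 301 * e1^2 + 85 * e2 + 672 * e1 + 460) = 0"
    using det[of "3 * t + 3" "3 * g * t + 7 * g + 6 * t^2 + 27 * t + 32" "3 * g^2 + 12 * g * t + 25 * g + 33 * t + 47"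
        "3 * g + 3" "- (3 * t^2 + 13 * t + 14)" "6 * g^2 - 3 * g * t + 18 * g - 7 * t + 1"
        "3 * g - 3 * t + 6" "- (6 * t^2 + 16 * t + 8)" "- (18 * g * t + 7 * g + 47 * t + 18)"] r0 r2 r3
    unfolding e1_def e2_def r by algebra
  then show "18 * e1^2 * e2 + 42 * e1^3 + 87 * e1 * e2 + 301 * e1^2 + 85 * e2 + 672 * e1 + 460 = 0"
    using nz by simp
  have "r * (g - t) * (3 * e1^2 * e2 + 7 * e1^3 + 15 * e1 * e2 + 53 * e1^2 + 15 * e2 + 125 * e1 + 90) = 0"
    using det[of "3 * t + 3" "3 * g * t + 7 * g + 6 * t^2 + 27 * t + 32" "3 * g^2 + 12 * g * t + 25 * g + 33 * t + 47"
        "3 * g^2 + 9 * g - 3 * t^2 - 9 * t" "- (12 * g * t^2 + 34 * g * t + 14 * g + 12 * t^3 + 75 * t^2 + 128 * t + 40)"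
        "- (12 * g^2 * t + 6 * g^2 + 12 * g * t^2 + 70 * g * t + 29 * g + 33 * t^2 + 113 * t + 40)"
        "3 * g + 3" "- (3 * t^2 + 13 * t + 14)" "6 * g^2 - 3 * g * t + 18 * g - 7 * t + 1"] r0 r1 r2
    unfolding e1_def e2_def r by algebra
  then show "g \<noteq> t \<Longrightarrow> 3 * e1^2 * e2 + 7 * e1^3 + 15 * e1 * e2 + 53 * e1^2 + 15 * e2 + 125 * e1 + 90 = 0"
    using nz by simp
  have "r * (g - t) * (9 * e1 * e2 + 11 * e1^2 + 25 * e2 + 64 * e1 + 100) = 0"
    using det[of "3 * g^2 + 9 * g - 3 * t^2 - 9 * t" "- (12 * g * t^2 + 34 * g * t + 14 * g + 12 * t^3 + 75 * t^2 + 128 * t + 40)"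
        "- (12 * g^2 * t + 6 * g^2 + 12 * g * t^2 + 70 * g * t + 29 * g + 33 * t^2 + 113 * t + 40)"
        "3 * g - 3 * t + 6" "- (6 * t^2 + 16 * t + 8)" "- (18 * g * t + 7 * g + 47 * t + 18)"
        "3 * g - 3 * t - 6" "- (6 * g * t + 14 * g + 12 * t^2 + 64 * t + 84)" "6 * g^2 - 12 * g * t - 7 * g - 33 * t - 74"] r1 r3 r4
    unfolding e1_def e2_def r by algebra
  then show "g \<noteq> t \<Longrightarrow> 9 * e1 * e2 + 11 * e1^2 + 25 * e2 + 64 * e1 + 100 = 0"
    using nz by simp
qed

text \<open>
  The three equations imply \<open>e2 = 4 e1^2 + 17 e1 + 14\<close>, and then \<open>e1\<close> is a root of a cubic polynomial. Its
  root \<open>- 5/2\<close> violates the second equation.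
\<close>

lemma one_zero_weight_solutions:
  fixes e1 e2 :: real
  assumes "18 * e1^2 * e2 + 42 * e1^3 + 87 * e1 * e2 + 301 * e1^2 + 85 * e2 + 672 * e1 + 460 = 0"
    and "3 * e1^2 * e2 + 7 * e1^3 + 15 * e1 * e2 + 53 * e1^2 + 15 * e2 + 125 * e1 + 90 = 0"
    and "9 * e1 * e2 + 11 * e1^2 + 25 * e2 + 64 * e1 + 100 = 0"
  shows "e1 = -10/3 \<and> e2 = 16/9 \<or> e1 = -3/2 \<and> e2 = -5/2"
proof -
  have e2: "e2 = 4 * e1^2 + 17 * e1 + 14" using assms by algebra
  have "(3 * e1 + 10) * (2 * e1 + 3) * (2 * e1 + 5) = 0"
    using assms unfolding e2 by algebra
  then consider "e1 = -10/3" | "e1 = -3/2" | "e1 = -5/2" by force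
  then show ?thesis
  proof cases
    case 3
    with assms(2) show ?thesis unfolding e2 by (simp add: power2_eq_square power3_eq_cube)
  qed (simp_all add: e2 power2_eq_square)
qed

section \<open>Reduction to representative weights\<close>

text \<open>
  Quantifying over all solutions makes this a property of the weights alone. It is invariant under the
  symmetric group acting on \<open>lam\<close>, \<open>\<gamma>\<close>, \<open>\<tau>\<close>, \<open>- 4 - lam - \<gamma> - \<tau>\<close>, which is generated by the two
  transpositions of neighbouring slots and the dualization in the first slot.
\<close>

definition settled :: "real \<Rightarrow> real \<Rightarrow> real \<Rightarrow> bool" where
  "settled lam \<gamma> \<tau> \<longleftrightarrow> (\<forall>c. inv_coeffs lam \<gamma> \<tau> c \<longrightarrow> nonzero_coeffs c \<longrightarrow> classified lam \<gamma> \<tau> c)"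

lemma settledI: "(\<And>c. inv_coeffs lam \<gamma> \<tau> c \<Longrightarrow> normal_form lam \<gamma> \<tau> (hom_op c)) \<Longrightarrow> settled lam \<gamma> \<tau>"
  unfolding settled_def using classifiedI by blast

lemma settled_swap12: "settled \<gamma> lam \<tau> \<Longrightarrow> settled lam \<gamma> \<tau>"
  unfolding settled_def using classified_swap12 inv_coeffs_swap12 nonzero_coeffs_swap12 by blast

lemma settled_swap23: "settled lam \<tau> \<gamma> \<Longrightarrow> settled lam \<gamma> \<tau>"
  unfolding settled_def using classified_swap23 inv_coeffs_swap23 nonzero_coeffs_swap23 by blast

lemma settled_dual1: "settled (- 4 - lam - \<gamma> - \<tau>) \<gamma> \<tau> \<Longrightarrow> settled lam \<gamma> \<tau>"
  unfolding settled_def using classified_dual inv_coeffs_dual nonzero_coeffs_dual by blast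

lemma settled_dual3:
  assumes "settled lam \<gamma> (- 4 - lam - \<gamma> - \<tau>)"
  shows "settled lam \<gamma> \<tau>"
proof -
  have "settled (- 4 - lam - \<gamma> - \<tau>) lam \<gamma>"
    by (rule settled_swap12, rule settled_swap23, rule assms)
  then have "settled (- 4 - \<tau> - lam - \<gamma>) lam \<gamma>"
    by (simp add: algebra_simps)
  then have "settled \<tau> lam \<gamma>" by (rule settled_dual1)
  then have "settled lam \<tau> \<gamma>" by (rule settled_swap12)
  then show ?thesis by (rule settled_swap23)
qed

text \<open>
  At \<open>\<tau> = - 4\<close> the fourth weight is zero and dualization in the third slot leads back to \<open>\<tau> = 0\<close>.
\<close>

lemma settled_two_zeros: "settled 0 0 \<tau>"
proof -
  have 0: "settled 0 0 0" by (rule settledI, rule normal_form_0_0_0)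
  consider "\<tau> = 0" | "\<tau> = - 2" | "\<tau> = - 4" | "\<tau> \<noteq> 0" "\<tau> \<noteq> - 2" "\<tau> \<noteq> - 4" by blast
  then show ?thesis
  proof cases
    case 1 then show ?thesis using 0 by simp
  next
    case 2 then show ?thesis by (auto intro: settledI normal_form_0_0_neg2)
  next
    case 3
    show ?thesis by (rule settled_dual3) (simp add: 3 0)
  next
    case 4 then show ?thesis by (intro settledI normal_form_Delta3)
  qed
qed

text \<open>
  Two of the three nonzero weights can be moved into the last two slots. Unless all three are equal,
  they can be chosen distinct, and then \<open>one_zero_weight\<close> determines their sum and product. Equal weights
  \<open>- 4/3\<close> are excluded by the first polynomial.
\<close>

lemma settled_one_zero:
  assumes nz: "g \<noteq> 0" "t \<noteq> 0" "- 4 - g - t \<noteq> 0"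
  shows "settled 0 g t"
proof -
  have Gz: "settled 0 (-2/3) (-8/3)"
    proof -
    have "settled (-2/3) (-2/3) 0" by (rule settledI, rule normal_form_Gz)
    then have "settled (-2/3) 0 (-2/3)" by (rule settled_swap23)
    then have "settled 0 (-2/3) (-2/3)" by (rule settled_swap12)
    then show ?thesis by (intro settled_dual3[of 0 "-2/3" "-8/3"]) simp
  qed
  have Xi: "settled 0 1 (-5/2)"
    by (rule settled_swap23, rule settled_swap12) (rule settledI, rule normal_form_Xi)
  have distinct: "settled 0 g t" if nz: "g \<noteq> 0" "t \<noteq> 0" "- 4 - g - t \<noteq> 0" and "g \<noteq> t" for g t
    unfolding settled_def
  proof (intro allI impI)
    fix c assume c: "inv_coeffs 0 g t c" "nonzero_coeffs c"
    note S = one_zero_weight[OF c refl nz]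
    have "g + t = -10/3 \<and> g * t = 16/9 \<or> g + t = -3/2 \<and> g * t = -5/2"
      using one_zero_weight_solutions[OF S(1) S(2,3)[OF \<open>g \<noteq> t\<close>]] .
    then have "g + t = -10/3 \<and> (3 * g + 2) * (3 * g + 8) = 0 \<or> g + t = -3/2 \<and> (g - 1) * (2 * g + 5) = 0"
      by algebra
    then consider "g = -2/3" "t = -8/3" | "g = -8/3" "t = -2/3" | "g = 1" "t = -5/2" | "g = -5/2" "t = 1"
      by force
    then have "settled 0 g t"
      using Gz Xi settled_swap23 by cases auto
    with c show "classified 0 g t c" unfolding settled_def by blast
  qed
  show ?thesis
  proof (cases "g = t")
    case False then show ?thesis using distinct nz by blast
  next
    case gt: True
    show ?thesis
    proof (cases "g = - 4 - g - t")
      case True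
      with gt have g: "g = -4/3" "t = -4/3" by simp_all
      show ?thesis
        unfolding settled_def
      proof (intro allI impI)
        fix c assume c: "inv_coeffs 0 g t c" "nonzero_coeffs c"
        show "classified 0 g t c"
          using one_zero_weight(1)[OF c refl nz] unfolding g by (simp add: power2_eq_square power3_eq_cube)
      qed
    next
      case False
      then have "settled 0 g (- 4 - 0 - g - t)" using nz by (intro distinct) auto
      then show ?thesis by (rule settled_dual3)
    qed
  qed
qed

lemma settled_zero: "settled 0 g t"
proof -
  consider "g = 0" | "t = 0" | "- 4 - g - t = 0" | "g \<noteq> 0" "t \<noteq> 0" "- 4 - g - t \<noteq> 0" by blast
  then show ?thesis
  proof cases
    case 1 then show ?thesis using settled_two_zeros by simp
  next
    case 2
    have "settled 0 g 0" by (rule settled_swap23, rule settled_two_zeros)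
    with 2 show ?thesis by simp
  next
    case 3
    have "settled 0 g 0" by (rule settled_swap23, rule settled_two_zeros)
    with 3 show ?thesis by (intro settled_dual3[of 0 g t]) simp
  next
    case 4 then show ?thesis by (rule settled_one_zero)
  qed
qed

lemma settled_Gamma_weights:
  "settled (-2/3) (-2/3) (-4/3)" "settled (-2/3) (-4/3) (-2/3)" "settled (-4/3) (-2/3) (-2/3)"
  "settled (-2/3) (-4/3) (-4/3)" "settled (-4/3) (-2/3) (-4/3)" "settled (-4/3) (-4/3) (-2/3)"
proof -
  show 1: "settled (-2/3) (-2/3) (-4/3)" by (rule settledI, rule normal_form_Gamma)
  show 2: "settled (-2/3) (-4/3) (-2/3)" by (rule settled_swap23, rule 1)
  show "settled (-4/3) (-2/3) (-2/3)" by (rule settled_swap12, rule 2)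
  show 3: "settled (-2/3) (-4/3) (-4/3)" by (rule settled_dual3) (use 2 in simp)
  show 4: "settled (-4/3) (-2/3) (-4/3)" by (rule settled_swap12, rule 3)
  show "settled (-4/3) (-4/3) (-2/3)" by (rule settled_swap23, rule 4)
qed

text \<open>
  In the \<open>\<Theta>\<close> case three of the weights are \<open>- 1 - p\<close> and the fourth is \<open>3 p - 1\<close>; in the \<open>\<Gamma>\<close> case two
  weights are \<open>- 2/3\<close> and two are \<open>- 4/3\<close>.
\<close>

lemma settled_no_zero:
  assumes nz: "lam \<noteq> 0" "\<gamma> \<noteq> 0" "\<tau> \<noteq> 0" "- 4 - lam - \<gamma> - \<tau> \<noteq> 0"
  shows "settled lam \<gamma> \<tau>"
  unfolding settled_def
proof (intro allI impI)
  fix c assume c: "inv_coeffs lam \<gamma> \<tau> c" "nonzero_coeffs c"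
  obtain A B C X Y Z where vd: "vertex_data A B C X Y Z c"
    and w: "lam = A + B + C - 1" "\<gamma> = A - B - C - 1" "\<tau> = B - A - C - 1"
    using vertex_data_exists[OF c(1)] .
  have "C - A - B - 1 \<noteq> 0" using nz(4) w by simp
  then have "9 * A\<^sup>2 = 1 \<and> B = 0 \<and> C = 0 \<or> 9 * B\<^sup>2 = 1 \<and> A = 0 \<and> C = 0 \<or> 9 * C\<^sup>2 = 1 \<and> A = 0 \<and> B = 0
    \<or> (\<exists>p. 12 * p\<^sup>2 + 6 * p = 1 \<and> (A, B, C) \<in> {(p, p, p), (p, -p, -p), (-p, p, -p), (-p, -p, p)})"
    using nonzero_weights_solutions[OF vd c(2)] nz(1-3) unfolding w by blast
  moreover have third: "x = 1/3 \<or> x = -1/3" if "9 * x\<^sup>2 = 1" for x :: real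
  proof -
    have "(3 * x - 1) * (3 * x + 1) = 0" using that by algebra
    then show ?thesis by force
  qed
  moreover have "settled lam \<gamma> \<tau>"
    if p: "12 * p\<^sup>2 + 6 * p = 1" and ABC: "(A, B, C) \<in> {(p, p, p), (p, -p, -p), (-p, p, -p), (-p, -p, p)}" for p
  proof -
    have "12 * (- 1 - p)^2 + 18 * (- 1 - p) + 5 = 0" using p by algebra
    then have 1: "settled (- 1 - p) (- 1 - p) (- 1 - p)"
      by (intro settledI normal_form_Theta)
    have 2: "settled (3 * p - 1) (- 1 - p) (- 1 - p)"
      by (rule settled_dual1) (use 1 in \<open>simp add: algebra_simps\<close>)
    have 3: "settled (- 1 - p) (3 * p - 1) (- 1 - p)"
      by (rule settled_swap12, rule 2)
    have 4: "settled (- 1 - p) (- 1 - p) (3 * p - 1)"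
      by (rule settled_swap23, rule 3)
    have "(lam, \<gamma>, \<tau>) \<in> {(3 * p - 1, - 1 - p, - 1 - p), (- 1 - p, 3 * p - 1, - 1 - p), (- 1 - p, - 1 - p, 3 * p - 1),
        (- 1 - p, - 1 - p, - 1 - p)}"
      using ABC unfolding w by auto
    with 1 2 3 4 show ?thesis by auto
  qed
  ultimately have "settled lam \<gamma> \<tau>"
    unfolding w using settled_Gamma_weights by (elim disjE exE conjE) (auto dest!: third)
  with c show "classified lam \<gamma> \<tau> c" unfolding settled_def by blast
qed

lemma settled_all: "settled lam \<gamma> \<tau>"
proof -
  consider "lam = 0" | "\<gamma> = 0" | "\<tau> = 0" | "- 4 - lam - \<gamma> - \<tau> = 0"
    | "lam \<noteq> 0" "\<gamma> \<noteq> 0" "\<tau> \<noteq> 0" "- 4 - lam - \<gamma> - \<tau> \<noteq> 0" by blast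
  then show ?thesis
  proof cases
    case 1 then show ?thesis using settled_zero by simp
  next
    case 2
    have "settled lam 0 \<tau>" by (rule settled_swap12, rule settled_zero)
    with 2 show ?thesis by simp
  next
    case 3
    have "settled lam \<gamma> 0" by (rule settled_swap23, rule settled_swap12, rule settled_zero)
    with 3 show ?thesis by simp
  next
    case 4
    have "settled (- 4 - lam - \<gamma> - \<tau>) \<gamma> \<tau>" unfolding 4 by (rule settled_zero)
    then show ?thesis by (rule settled_dual1)
  next
    case 5 then show ?thesis by (rule settled_no_zero)
  qed
qed

theorem theorem2p6:
  fixes lam \<gamma> \<tau> :: real
    and A :: "density \<Rightarrow> density \<Rightarrow> density \<Rightarrow> density"
  assumes "diffop_of_order 5 A"
    and "vect_invariant lam \<gamma> \<tau> (lam + \<gamma> + \<tau> + 5) A"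
  shows "\<exists>lam' \<gamma>' \<tau>' B.
    perm_dual (TernOp lam \<gamma> \<tau> (lam + \<gamma> + \<tau> + 5) A)
              (TernOp lam' \<gamma>' \<tau>' (lam' + \<gamma>' + \<tau>' + 5) B) \<and>
    (lam' = 0 \<and> \<gamma>' = 0 \<and> \<tau>' = 0 \<and>
       (\<exists>\<epsilon>1 \<epsilon>2. \<forall>\<phi> \<psi> chi. B \<phi> \<psi> chi =
          smult \<epsilon>1 (poisson 3 1 (poisson 1 1 (dR \<phi>) (dR \<psi>)) (dR chi)) +
          smult \<epsilon>2 (poisson 3 1 (poisson 1 1 (dR chi) (dR \<phi>)) (dR \<psi>)))
   \<or> lam' = 0 \<and> \<gamma>' = 0 \<and> \<tau>' = -2 \<and>
       (\<exists>\<epsilon>1 \<epsilon>2. \<forall>\<phi> \<psi> chi. B \<phi> \<psi> chi =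
          smult \<epsilon>1 (poisson 1 1 (dR (poisson 1 (-2) (dR \<phi>) chi)) (dR \<psi>)) +
          smult \<epsilon>2 (poisson 1 1 (dR (poisson 1 (-2) (dR \<psi>) chi)) (dR \<phi>)))
   \<or> lam' = 0 \<and> \<gamma>' = 0 \<and> \<tau>' \<noteq> -4 \<and> \<tau>' \<noteq> -2 \<and> \<tau>' \<noteq> 0 \<and>
       (\<exists>c. \<forall>\<phi> \<psi> chi. B \<phi> \<psi> chi = smult c (Delta3 1 1 \<tau>' (dR \<phi>) (dR \<psi>) chi))
   \<or> lam' = -2/3 \<and> \<gamma>' = -2/3 \<and> \<tau>' = 0 \<and>
       (\<exists>c. \<forall>\<phi> \<psi> chi. B \<phi> \<psi> chi = smult c (poisson (5/3) 1 (Gz \<phi> \<psi>) (dR chi)))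
   \<or> lam' = -5/2 \<and> \<gamma>' = 0 \<and> \<tau>' = 1 \<and>
       (\<exists>c. \<forall>\<phi> \<psi> chi. B \<phi> \<psi> chi = smult c (Xi 1 \<phi> (dR \<psi>) chi))
   \<or> lam' = -2/3 \<and> \<gamma>' = -2/3 \<and> \<tau>' = -4/3 \<and>
       (\<exists>c. \<forall>\<phi> \<psi> chi. B \<phi> \<psi> chi = smult c (Gamma_op \<phi> \<psi> chi))
   \<or> (\<exists>s \<in> {1, -1}. lam' = Theta_weight s \<and> \<gamma>' = Theta_weight s \<and> \<tau>' = Theta_weight s \<and>
       (\<exists>c. \<forall>\<phi> \<psi> chi. B \<phi> \<psi> chi = smult c (Theta s \<phi> \<psi> chi))))"
proof -
  obtain c where c: "A = hom_op c" "inv_coeffs lam \<gamma> \<tau> c" "nonzero_coeffs c"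
    using invariant_diffop_coeffs[OF assms] .
  then have "classified lam \<gamma> \<tau> c"
    using settled_all unfolding settled_def by blast
  then show ?thesis
    unfolding classified_def normal_form_def c(1) .
qed

end
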